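(* Let $\Omega\subsetneq\mathbb{C}$ be a convex domain (nonempty, open), with Poincaré metric $\lambda(w)|dw|$. Then the level sets of $\lambda$ in $\Omega$ have nonnegative curvature. If the curvature of any level set is zero at a single point, then $\Omega$ is a parallel strip or a half-plane, and all level sets of $\lambda$ have zero curvature.
   Context: Let $\mathbb{D}=\{z\in\mathbb{C}:|z|<1\}$. The Poincaré metric $\lambda(w)|dw|$ of $\Omega$ is defined by $\lambda(w)|dw|=|dz|/(1-|z|^2)$ with $w=f(z)$, where $f$ is a conformal mapping of $\mathbb{D}$ onto $\Omega$; that is, $\lambda(f(z))\,|f'(z)|=1/(1-|z|^2)$ (independent of the choice of $f$). A level set of $\lambda$ is a nonempty set $\{w\in\Omega:\lambda(w)=c\}$, $c$ constant. At points where $\nabla\lambda\neq0$ it is a smooth curve, and its curvature is the Euclidean signed curvature $\kappa$, with the sign chosen so that, for an arclength parametrization $w(s)$, $w''=-\kappa\,\nabla\lambda/|\nabla\lambda|$ (gradient identified with a complex number); equivalently $\kappa=\mathrm{div}(\nabla\lambda/|\nabla\lambda|)$. Thus curvature is nonnegative when the level curve bends toward the side of smaller $\lambda$, as for the boundary of a convex sublevel set $\{\lambda\le c\}$. Curvature is considered only away from critical points of $\lambda$; in the case of a parallel strip, where $\nabla\lambda=0$ all along the central line, that line is itself a level set and is regarded as having zero curvature. A parallel strip is the open region of $\mathbb{C}$ between two distinct parallel lines. *)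

theory Defs
  imports "HOL-Complex_Analysis.Complex_Analysis"
begin

definition conformal_map_onto :: "(complex \<Rightarrow> complex) \<Rightarrow> complex set \<Rightarrow> bool" where
  "conformal_map_onto f \<Omega> \<longleftrightarrow>
     f holomorphic_on ball 0 1 \<and> inj_on f (ball 0 1) \<and> f ` ball 0 1 = \<Omega>"

text \<open>
  The value does not depend on the conformal map, so the description is proper whenever the
  unit disc can be mapped conformally onto the domain; there is no factor 2, that is, the
  metric has curvature -4.
\<close>
definition poincare_density :: "complex set \<Rightarrow> complex \<Rightarrow> real" where
  "poincare_density \<Omega> w =
     (THE l. \<exists>f z. conformal_map_onto f \<Omega> \<and> z \<in> ball 0 1 \<and> f z = w \<and>
                   l * norm (deriv f z) = 1 / (1 - (norm z)\<^sup>2))"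

definition level_set :: "complex set \<Rightarrow> real \<Rightarrow> complex set" where
  "level_set \<Omega> c = {w \<in> \<Omega>. poincare_density \<Omega> w = c}"

definition grad :: "(complex \<Rightarrow> real) \<Rightarrow> complex \<Rightarrow> complex" where
  "grad u w = (THE D. GDERIV u w :> D)"

text \<open>
  \<open>g\<close> is an arclength parametrization of a piece of \<open>L\<close> around the point \<open>w = g 0\<close>, with
  second derivative \<open>a\<close> at that point.
\<close>
definition arclength_param_at ::
    "(real \<Rightarrow> complex) \<Rightarrow> complex set \<Rightarrow> complex \<Rightarrow> complex \<Rightarrow> bool" where
  "arclength_param_at g L w a \<longleftrightarrow>
     g 0 = w \<and>
     (\<exists>e>0. \<exists>g'. (\<forall>s\<in>{-e<..<e}. g s \<in> L \<and> (g has_vector_derivative g' s) (at s) \<and> norm (g' s) = 1)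
            \<and> (g' has_vector_derivative a) (at 0))"

text \<open>
  Signed curvature at \<open>w\<close>, a noncritical point of the density; it is nonnegative when the curve
  bends towards smaller values of the density. Note that \<open>sgn v = v /\<^sub>R norm v\<close>.
\<close>
definition signed_curvature :: "complex set \<Rightarrow> real \<Rightarrow> complex \<Rightarrow> real" where
  "signed_curvature \<Omega> c w =
     (THE \<kappa>. \<exists>g. arclength_param_at g (level_set \<Omega> c) w
                   (- \<kappa> *\<^sub>R sgn (grad (poincare_density \<Omega>) w)))"

definition parallel_strip :: "complex set \<Rightarrow> bool" where
  "parallel_strip S \<longleftrightarrow> (\<exists>n a b. n \<noteq> 0 \<and> a < b \<and> S = {w. a < n \<bullet> w \<and> n \<bullet> w < b})"

definition half_plane :: "complex set \<Rightarrow> bool" where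
  "half_plane S \<longleftrightarrow> (\<exists>n a. n \<noteq> 0 \<and> S = {w. a < n \<bullet> w})"

definition straight_line :: "complex set \<Rightarrow> bool" where
  "straight_line L \<longleftrightarrow> (\<exists>n a. n \<noteq> 0 \<and> L = {w. n \<bullet> w = a})"

text \<open>
  Level sets have no curvature at critical points of the density, with one exception: in a
  parallel strip the critical points fill the central line, which is a level set and is given
  curvature zero.
\<close>
definition has_level_curvature :: "complex set \<Rightarrow> real \<Rightarrow> complex \<Rightarrow> real \<Rightarrow> bool" where
  "has_level_curvature \<Omega> c w \<kappa> \<longleftrightarrow>
     w \<in> level_set \<Omega> c \<and>
     (if grad (poincare_density \<Omega>) w \<noteq> 0 then \<kappa> = signed_curvature \<Omega> c w
      else parallel_strip \<Omega> \<and> straight_line (level_set \<Omega> c) \<and> \<kappa> = 0)"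

end

theory Submission
  imports Defs
begin

text \<open>
  Near a point \<open>w\<close> use a conformal map \<open>f\<close> of the disc with \<open>f 0 = w\<close>, and let \<open>u\<close> be the logarithm
  of the density. The curvature of the level curve is \<open>\<langle>Hess u t, t\<rangle> / |grad u|\<close> with \<open>t\<close> the unit
  tangent, and it is a positive multiple of \<open>2 |p|\<^sup>2 + Re ((P' 0 - p\<^sup>2) (cnj p)\<^sup>2)\<close>, where
  \<open>P = f'' / f'\<close> and \<open>p = P 0\<close>. Convexity of \<open>\<Omega>\<close> gives \<open>Re (1 + z P z) \<ge> 0\<close>, that is,
  \<open>P = 2 \<phi> / (1 - z \<phi>)\<close> with \<open>|\<phi>| \<le> 1\<close>, and the Schwarz-Pick inequality
  \<open>|\<phi>' 0| \<le> 1 - |\<phi> 0|\<^sup>2\<close> makes the expression nonnegative. If it vanishes, \<open>\<phi>\<close> is a Moebius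
  map or a constant, \<open>f'\<close> is an explicit constant over a quadratic polynomial, and \<open>\<Omega>\<close>
  contains a full line, so it is a strip or a half-plane. Conversely, strips and half-planes are
  invariant under translations along a line, so their level sets contain straight lines.
\<close>

subsection \<open>Conformal maps and the density\<close>

text \<open>Passing to the logarithm keeps level sets and gradient directions, and it splits the
  pulled-back density into \<open>- ln (1 - |z|^2)\<close> and the harmonic term
  \<open>- ln |f'|\<close>. At the centre the first contributes a rotation-invariant part to the
  Hessian of \<open>u\<close>, the second the real part of a complex quadratic form. The function
  \<open>\<phi>\<close> comes from a Cayley transform: \<open>1 + z P\<close> lies in the closed
  right half-plane, so \<open>z P / (2 + z P)\<close> maps the disc to itself and vanishes at 0, and
  the Schwarz lemma allows \<open>z\<close> to be divided out. In the extremal case the quadratic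
  has its zeros on the unit circle: two simple zeros belong to a strip, a double zero to a
  half-plane, and one flow argument covers both. Curvature is a definite description over arclength
  parametrizations, so a level curve must be constructed before the Hessian formula says anything
  about it. The converse also has to locate the critical points: in a strip they must fill a whole
  level line, in a half-plane there must be none.\<close>

lemma conformal_map_inverse:
  assumes "conformal_map_onto f \<Omega>"
  obtains F where "open \<Omega>" "F holomorphic_on \<Omega>" "F ` \<Omega> \<subseteq> ball 0 1"
    "\<And>w. w \<in> \<Omega> \<Longrightarrow> f (F w) = w" "\<And>z. z \<in> ball 0 1 \<Longrightarrow> F (f z) = z"
    "\<And>z. z \<in> ball 0 1 \<Longrightarrow> deriv f z \<noteq> 0"
    "\<And>w. w \<in> \<Omega> \<Longrightarrow> (F has_field_derivative 1 / deriv f (F w)) (at w)"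
proof -
  have f: "f holomorphic_on ball 0 1" "inj_on f (ball 0 1)" "f ` ball 0 1 = \<Omega>"
    using assms by (auto simp: conformal_map_onto_def)
  obtain F where F: "F holomorphic_on \<Omega>" "\<And>z. z \<in> ball 0 1 \<Longrightarrow> deriv f z * deriv F (f z) = 1"
      "\<And>z. z \<in> ball 0 1 \<Longrightarrow> F (f z) = z"
    using holomorphic_has_inverse[OF f(1) open_ball f(2)] unfolding f(3) by metis
  have op: "open \<Omega>"
    using open_mapping_thm3[OF f(1) open_ball f(2)] f(3) by simp
  have im: "F w \<in> ball 0 1" "f (F w) = w" if "w \<in> \<Omega>" for w
    using that F(3) f(3) by fastforce+
  have "(F has_field_derivative 1 / deriv f (F w)) (at w)" if "w \<in> \<Omega>" for w
  proof -
    have "deriv F w = 1 / deriv f (F w)"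
      using F(2)[OF im(1)[OF that]] im(2)[OF that] by (simp add: field_simps)
         (metis mult_zero_left mult_zero_right nonzero_eq_divide_eq zero_neq_one)
    thus ?thesis
      using holomorphic_derivI[OF F(1) op that] by simp
  qed
  thus thesis
    using that[of F] op F im by (metis image_subsetI mult_zero_left zero_neq_one)
qed

text \<open>\<open>Moebius_function 0 (- a)\<close> is the disc automorphism
  \<open>(z + a) / (1 + cnj a * z)\<close>, which sends 0 to \<open>a\<close> with derivative
  \<open>1 - (norm a)\<^sup>2\<close>. Precomposing with it absorbs the weight in the density, so
  densities can be compared, and Hessians computed, at the centre.\<close>

lemma conformal_map_recenter:
  assumes f: "conformal_map_onto f \<Omega>" and a: "a \<in> ball 0 1"
  defines "g \<equiv> \<lambda>z. f (Moebius_function 0 (- a) z)"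
  shows "conformal_map_onto g \<Omega>" "g 0 = f a"
    "deriv g 0 = deriv f a * of_real (1 - (norm a)\<^sup>2)"
proof -
  let ?M = "Moebius_function 0 (- a)" and ?N = "Moebius_function 0 a"
  have fh: "f holomorphic_on ball 0 1" and fi: "inj_on f (ball 0 1)" and fim: "f ` ball 0 1 = \<Omega>"
    using f by (auto simp: conformal_map_onto_def)
  have Mh: "?M holomorphic_on ball 0 1"
    using a by (intro Moebius_function_holomorphic) auto
  have Min: "?M z \<in> ball 0 1" "?N z \<in> ball 0 1" if "z \<in> ball 0 1" for z
    using a that by (auto intro!: Moebius_function_norm_lt_1)
  have NM: "?N (?M z) = z" "?M (?N z) = z" if "z \<in> ball 0 1" for z
    using a that by (auto intro!: Moebius_function_compose)
  have "?M ` ball 0 1 = ball 0 1"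
    using Min NM by force
  hence im: "g ` ball 0 1 = \<Omega>"
    using fim unfolding g_def by (metis image_image)
  have "inj_on g (ball 0 1)"
    unfolding inj_on_def g_def by (metis Min(1) NM(1) fi inj_onD)
  moreover have "g holomorphic_on ball 0 1"
    using holomorphic_on_compose_gen[OF Mh fh] Min unfolding g_def o_def by blast
  ultimately show "conformal_map_onto g \<Omega>"
    using im by (simp add: conformal_map_onto_def)
  show "g 0 = f a"
    by (simp add: g_def Moebius_function_of_zero)
  have "(?M has_field_derivative of_real (1 - (norm a)\<^sup>2)) (at 0)"
    unfolding Moebius_function_def
    by (rule derivative_eq_intros refl | simp)+
      (simp add: complex_norm_square mult.commute algebra_simps flip: of_real_power)
  moreover have "(f has_field_derivative deriv f a) (at (?M 0))"
    using holomorphic_derivI[OF fh open_ball a] by (simp add: Moebius_function_of_zero)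
  ultimately have "(g has_field_derivative deriv f a * of_real (1 - (norm a)\<^sup>2)) (at 0)"
    unfolding g_def by (rule DERIV_chain2[rotated])
  thus "deriv g 0 = deriv f a * of_real (1 - (norm a)\<^sup>2)"
    by (rule DERIV_imp_deriv)
qed

text \<open>With \<open>G\<close> the inverse of \<open>g\<close>, the map
  \<open>G \<circ> f\<close> is a self-map of the disc fixing 0, and the Schwarz lemma bounds its
  derivative \<open>deriv f 0 / deriv g 0\<close>.\<close>

lemma conformal_maps_norm_deriv_le:
  assumes f: "conformal_map_onto f \<Omega>" and g: "conformal_map_onto g \<Omega>" and eq: "f 0 = g 0"
  shows "norm (deriv f 0) \<le> norm (deriv g 0)"
proof -
  obtain G where G: "open \<Omega>" "G holomorphic_on \<Omega>" "G ` \<Omega> \<subseteq> ball 0 1"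
      "\<And>z. z \<in> ball 0 1 \<Longrightarrow> G (g z) = z" "\<And>z. z \<in> ball 0 1 \<Longrightarrow> deriv g z \<noteq> 0"
      "\<And>w. w \<in> \<Omega> \<Longrightarrow> (G has_field_derivative 1 / deriv g (G w)) (at w)"
    using conformal_map_inverse[OF g] by metis
  have f': "f holomorphic_on ball 0 1" "f ` ball 0 1 = \<Omega>"
    using f by (auto simp: conformal_map_onto_def)
  have h: "(\<lambda>z. G (f z)) holomorphic_on ball 0 1"
    using holomorphic_on_compose_gen[OF f'(1) G(2)] f'(2) by (auto simp: o_def)
  have f0: "f 0 \<in> \<Omega>"
    using f'(2) by auto
  have G0: "G (f 0) = 0"
    using eq G(4) by simp
  have "norm (G (f z)) < 1" if "norm z < 1" for z
    using that f'(2) G(3) by (force simp: image_subset_iff)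
  hence "norm (deriv (\<lambda>z. G (f z)) 0) \<le> 1"
    using Schwarz_Lemma(2)[OF h G0, of 0] by simp
  moreover have "((\<lambda>z. G (f z)) has_field_derivative 1 / deriv g 0 * deriv f 0) (at 0)"
    using DERIV_chain2[of G "1 / deriv g 0" f 0 "deriv f 0"] G(6)[OF f0] G0
      holomorphic_derivI[OF f'(1) open_ball, of 0] by simp
  ultimately show ?thesis
    using G(5)[of 0] by (auto dest!: DERIV_imp_deriv simp: norm_divide norm_mult field_simps)
qed

lemma poincare_density_conformal_map:
  assumes f: "conformal_map_onto f \<Omega>" and z: "z \<in> ball 0 1"
  shows "poincare_density \<Omega> (f z) = 1 / ((1 - (norm z)\<^sup>2) * norm (deriv f z))"
proof -
  have pos: "0 < 1 - (norm a)\<^sup>2" if "a \<in> ball 0 1" for a :: complex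
    using that by (simp add: power_less_one_iff)
  have nz: "norm (deriv g a) > 0" if "conformal_map_onto g \<Omega>" "a \<in> ball 0 1" for g a
    using conformal_map_inverse[OF that(1)] that(2) by (metis zero_less_norm_iff)
  \<comment> \<open>Recentring moves both base points to 0, where the Schwarz comparison applies in
    both directions. This makes the definite description in \<open>poincare_density\<close>
    proper.\<close>
  have same: "(1 - (norm a)\<^sup>2) * norm (deriv g a) = (1 - (norm b)\<^sup>2) * norm (deriv h b)"
    if "conformal_map_onto g \<Omega>" "conformal_map_onto h \<Omega>" "a \<in> ball 0 1" "b \<in> ball 0 1" "g a = h b"
    for g h a b
  proof -
    note A = conformal_map_recenter[OF that(1,3)] and B = conformal_map_recenter[OF that(2,4)]
    have "norm (deriv g a * of_real (1 - (norm a)\<^sup>2)) = norm (deriv h b * of_real (1 - (norm b)\<^sup>2))"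
      unfolding A(3)[symmetric] B(3)[symmetric]
      using conformal_maps_norm_deriv_le[OF A(1) B(1)] conformal_maps_norm_deriv_le[OF B(1) A(1)]
        A(2) B(2) that(5) by (intro antisym) simp_all
    thus ?thesis
      unfolding norm_mult norm_of_real using pos[OF that(3)] pos[OF that(4)] by (simp add: mult.commute)
  qed
  show ?thesis
    unfolding poincare_density_def
  proof (rule the_equality)
    show "\<exists>fa za. conformal_map_onto fa \<Omega> \<and> za \<in> ball 0 1 \<and> fa za = f z \<and>
        1 / ((1 - (norm z)\<^sup>2) * norm (deriv f z)) * norm (deriv fa za) = 1 / (1 - (norm za)\<^sup>2)"
      using f z nz[OF f z] by (intro exI[of _ f] exI[of _ z]) auto
  next
    fix l
    assume "\<exists>fa za. conformal_map_onto fa \<Omega> \<and> za \<in> ball 0 1 \<and> fa za = f z \<and>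
        l * norm (deriv fa za) = 1 / (1 - (norm za)\<^sup>2)"
    then obtain g a where g: "conformal_map_onto g \<Omega>" "a \<in> ball 0 1" "g a = f z"
        and l: "l * norm (deriv g a) = 1 / (1 - (norm a)\<^sup>2)"
      by blast
    have "l = 1 / ((1 - (norm a)\<^sup>2) * norm (deriv g a))"
      using l nz[OF g(1,2)] pos[OF g(2)] by (simp add: field_simps)
    thus "l = 1 / ((1 - (norm z)\<^sup>2) * norm (deriv f z))"
      using same[OF g(1) f g(2) z g(3)] by simp
  qed
qed

lemma poincare_density_pos:
  assumes "conformal_map_onto f \<Omega>" and "w \<in> \<Omega>"
  shows "poincare_density \<Omega> w > 0"
proof -
  obtain F where F: "F ` \<Omega> \<subseteq> ball 0 1" "\<And>w. w \<in> \<Omega> \<Longrightarrow> f (F w) = w"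
      "\<And>z. z \<in> ball 0 1 \<Longrightarrow> deriv f z \<noteq> 0"
    using conformal_map_inverse[OF assms(1)] by metis
  have "F w \<in> ball 0 1"
    using F assms by auto
  thus ?thesis
    using poincare_density_conformal_map[OF assms(1), of "F w"] F(2)[OF assms(2)] F(3)[of "F w"]
    by (simp add: power_less_one_iff)
qed

text \<open>An affine automorphism of \<open>\<Omega>\<close> composed after \<open>f\<close> is
  another conformal map onto \<open>\<Omega>\<close>, with derivative multiplied by
  \<open>\<alpha>\<close>. The uses are translations and the dilations of a half-plane.\<close>

lemma poincare_density_affine:
  assumes f: "conformal_map_onto f \<Omega>" and \<alpha>: "\<alpha> \<noteq> 0"
    and inv: "(\<lambda>w. \<alpha> * w + \<beta>) ` \<Omega> = \<Omega>" and w: "w \<in> \<Omega>"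
  shows "poincare_density \<Omega> (\<alpha> * w + \<beta>) = poincare_density \<Omega> w / norm \<alpha>"
proof -
  let ?g = "\<lambda>z. \<alpha> * f z + \<beta>"
  have fh: "f holomorphic_on ball 0 1" and fi: "inj_on f (ball 0 1)" and fim: "f ` ball 0 1 = \<Omega>"
    using f by (auto simp: conformal_map_onto_def)
  have "?g ` ball 0 1 = \<Omega>"
    using inv unfolding fim[symmetric] image_image by simp
  moreover have "inj_on ?g (ball 0 1)"
    using fi \<alpha> by (auto simp: inj_on_def)
  ultimately have g: "conformal_map_onto ?g \<Omega>"
    using fh by (auto simp: conformal_map_onto_def intro!: holomorphic_intros)
  obtain z where z: "z \<in> ball 0 1" "f z = w"
    using w fim by auto
  have "(?g has_field_derivative \<alpha> * deriv f z) (at z)"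
    by (rule derivative_eq_intros holomorphic_derivI[OF fh open_ball z(1)] refl)+ simp
  hence "deriv ?g z = \<alpha> * deriv f z"
    by (rule DERIV_imp_deriv)
  thus ?thesis
    using poincare_density_conformal_map[OF f z(1)] poincare_density_conformal_map[OF g z(1)] z(2)
    by (simp add: norm_mult mult.assoc mult.left_commute)
qed

lemma conformal_map_centered_exists:
  assumes "open \<Omega>" "convex \<Omega>" "\<Omega> \<noteq> UNIV" "w \<in> \<Omega>"
  obtains f where "conformal_map_onto f \<Omega>" "f 0 = w"
proof -
  obtain F f where F: "f holomorphic_on ball 0 1" "\<And>z. z \<in> \<Omega> \<Longrightarrow> F z \<in> ball 0 1 \<and> f (F z) = z"
      "\<And>z. z \<in> ball 0 1 \<Longrightarrow> f z \<in> \<Omega> \<and> F (f z) = z"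
    using Riemann_mapping_theorem[of \<Omega>] assms convex_imp_simply_connected[OF assms(2)]
    by (metis empty_iff)
  have c: "conformal_map_onto f \<Omega>"
    unfolding conformal_map_onto_def
  proof (intro conjI)
    show "inj_on f (ball 0 1)"
      using F(3) by (intro inj_on_inverseI[of _ F]) blast
    have "w \<in> f ` ball 0 1" if "w \<in> \<Omega>" for w
      using F(2)[OF that] by (metis image_eqI)
    thus "f ` ball 0 1 = \<Omega>"
      using F(3) by blast
  qed (rule F(1))
  show thesis
    using conformal_map_recenter[OF c, of "F w"] F(2)[OF assms(4)] that by metis
qed

subsection \<open>Curvature of level curves\<close>

lemma has_real_derivative_along_curve:
  assumes "GDERIV u (g s) :> D" and "(g has_vector_derivative v) (at s)"
  shows "((\<lambda>s. u (g s)) has_real_derivative v \<bullet> D) (at s)"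
  using has_derivative_compose[OF assms(2)[unfolded has_vector_derivative_def] assms(1)[unfolded gderiv_def]]
  by (simp add: has_field_derivative_def mult_commute_abs)

lemma gradient_unique:
  fixes u :: "complex \<Rightarrow> real"
  assumes "GDERIV u w :> D"
  shows "grad u w = D"
  unfolding grad_def
proof (rule the_equality)
  fix E assume "GDERIV u w :> E"
  hence "(\<lambda>h. h \<bullet> E) = (\<lambda>h. h \<bullet> D)"
    using assms unfolding gderiv_def by (rule has_derivative_unique)
  thus "E = D"
    by (metis inner_commute vector_eq_rdot)
qed (rule assms)

text \<open>Serves to conclude that a vector with one vanishing component in the frame
  \<open>n\<close>, \<open>\<i> * n\<close> is a multiple of the other frame vector.\<close>

lemma complex_orthonormal_expansion:
  fixes n h :: complex
  assumes "norm n = 1"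
  shows "h = (h \<bullet> (\<i> * n)) *\<^sub>R (\<i> * n) + (h \<bullet> n) *\<^sub>R n"
proof -
  have "(Re n)\<^sup>2 + (Im n)\<^sup>2 = 1"
    using assms by (simp add: cmod_def)
  thus ?thesis
    by (simp add: complex_eq_iff inner_complex_def) algebra
qed

text \<open>Differentiating \<open>u (g s) = c\<close> gives
  \<open>g' s \<bullet> G (g s) = 0\<close>; differentiating this at 0 gives the first equation, and
  differentiating \<open>g' s \<bullet> g' s = 1\<close> the second. The velocity at 0 is
  \<open>t\<close> or \<open>- t\<close>, but the Hessian form is even, so the orientation drops
  out.\<close>

lemma arclength_param_curvature:
  fixes u :: "complex \<Rightarrow> real"
  assumes \<Omega>: "w0 \<in> \<Omega>" and G: "\<And>w. w \<in> \<Omega> \<Longrightarrow> GDERIV u w :> G w"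
    and G': "(G has_derivative G') (at w0)" and nz: "G w0 \<noteq> 0"
    and g: "arclength_param_at g {w \<in> \<Omega>. u w = c} w0 a"
  defines "t \<equiv> \<i> * sgn (G w0)"
  shows "a \<bullet> G w0 = - (G' t \<bullet> t)" "a \<bullet> t = 0"
proof -
  obtain e g' where e: "e > 0" and g0: "g 0 = w0"
      and g1: "\<And>s. s \<in> {-e<..<e} \<Longrightarrow> g s \<in> \<Omega> \<and> u (g s) = c"
      and g': "\<And>s. s \<in> {-e<..<e} \<Longrightarrow> (g has_vector_derivative g' s) (at s)"
      and n: "\<And>s. s \<in> {-e<..<e} \<Longrightarrow> norm (g' s) = 1"
      and a: "(g' has_vector_derivative a) (at 0)"
    using g unfolding arclength_param_at_def mem_Collect_eq by metis
  have zero: "0 \<in> {-e<..<e}"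
    using e by simp
  have orth: "g' s \<bullet> G (g s) = 0" if s: "s \<in> {-e<..<e}" for s
  proof -
    have "((\<lambda>s. u (g s)) has_real_derivative g' s \<bullet> G (g s)) (at s)"
      using s g1 g' G by (intro has_real_derivative_along_curve) auto
    moreover have "((\<lambda>s. u (g s)) has_real_derivative 0) (at s)"
      by (rule has_field_derivative_transform_within_open[OF DERIV_const[of c] _ s]) (use g1 in auto)
    ultimately show ?thesis
      by (rule DERIV_unique)
  qed
  have "((\<lambda>s. G (g s)) has_vector_derivative G' (g' 0)) (at 0)"
    using has_derivative_compose[OF g'[OF zero, unfolded has_vector_derivative_def] G'[folded g0]]
      linear_scale[OF has_derivative_linear[OF G']] by (simp add: has_vector_derivative_def)
  hence "((\<lambda>s. g' s \<bullet> G (g s)) has_derivative (\<lambda>h. g' 0 \<bullet> (h *\<^sub>R G' (g' 0)) + (h *\<^sub>R a) \<bullet> G (g 0))) (at 0)"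
    using a unfolding has_vector_derivative_def by (intro has_derivative_inner) auto
  moreover have "((\<lambda>s. g' s \<bullet> G (g s)) has_derivative (\<lambda>h. 0)) (at 0)"
    by (rule has_derivative_transform_within_open[OF has_derivative_const[of 0] open_greaterThanLessThan zero])
      (simp add: orth)
  ultimately have "(\<lambda>h. g' 0 \<bullet> (h *\<^sub>R G' (g' 0)) + (h *\<^sub>R a) \<bullet> G (g 0)) = (\<lambda>h. 0)"
    by (rule has_derivative_unique)
  from fun_cong[OF this, of 1] have eq: "g' 0 \<bullet> G' (g' 0) + a \<bullet> G w0 = 0"
    by (simp add: g0)
  have "((\<lambda>s. g' s \<bullet> g' s) has_derivative (\<lambda>h. g' 0 \<bullet> (h *\<^sub>R a) + (h *\<^sub>R a) \<bullet> g' 0)) (at 0)"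
    using a unfolding has_vector_derivative_def by (intro has_derivative_inner) auto
  moreover have "((\<lambda>s. g' s \<bullet> g' s) has_derivative (\<lambda>h. 0)) (at 0)"
    by (rule has_derivative_transform_within_open[OF has_derivative_const[of 1] open_greaterThanLessThan zero])
      (use n in \<open>simp add: norm_eq_1\<close>)
  ultimately have "(\<lambda>h. g' 0 \<bullet> (h *\<^sub>R a) + (h *\<^sub>R a) \<bullet> g' 0) = (\<lambda>h. 0)"
    by (rule has_derivative_unique)
  from fun_cong[OF this, of 1] have perp: "a \<bullet> g' 0 = 0"
    by (simp add: inner_commute)
  have sg: "norm (sgn (G w0)) = 1"
    using nz by (simp add: norm_sgn)
  have "g' 0 \<bullet> sgn (G w0) = 0"
    using orth[OF zero] by (simp add: g0 sgn_div_norm)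
  with complex_orthonormal_expansion[OF sg, of "g' 0"] have tt: "g' 0 = (g' 0 \<bullet> t) *\<^sub>R t"
    by (simp add: t_def)
  have "norm t = 1"
    using sg by (simp add: t_def norm_mult)
  with tt n[OF zero] have "\<bar>g' 0 \<bullet> t\<bar> = 1"
    by (metis mult.right_neutral norm_scaleR)
  then have "g' 0 = t \<or> g' 0 = - t"
    using tt by (metis abs_if minus_equation_iff scaleR_minus1_left scaleR_one)
  thus "a \<bullet> G w0 = - (G' t \<bullet> t)" "a \<bullet> t = 0"
    using eq perp linear_neg[OF has_derivative_linear[OF G'], of t] by (auto simp: inner_commute)
qed

text \<open>The new parameter \<open>\<sigma>\<close> is an antiderivative of \<open>\<rho>\<close>,
  strictly increasing as \<open>\<rho>\<close> is positive; the derivative of its inverse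
  \<open>\<tau>\<close> cancels the factor \<open>\<rho>\<close> in the velocity of
  \<open>\<gamma>\<close>.\<close>

lemma unit_speed_reparametrization:
  fixes \<gamma> :: "real \<Rightarrow> complex"
  assumes e: "e > 0" and \<rho>: "continuous_on {-e<..<e} \<rho>" "\<And>x. x \<in> {-e<..<e} \<Longrightarrow> \<rho> x > 0"
    and \<gamma>: "\<And>x. x \<in> {-e<..<e} \<Longrightarrow> (\<gamma> has_vector_derivative \<rho> x *\<^sub>R T (\<gamma> x)) (at x)"
  obtains \<delta> \<tau> where "\<delta> > 0" "\<tau> 0 = 0" "\<And>s. s \<in> {-\<delta><..<\<delta>} \<Longrightarrow> \<tau> s \<in> {-e<..<e}"
    "\<And>s. s \<in> {-\<delta><..<\<delta>} \<Longrightarrow> ((\<lambda>s. \<gamma> (\<tau> s)) has_vector_derivative T (\<gamma> (\<tau> s))) (at s)"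
proof -
  \<comment> \<open>Half the radius gives a compact interval inside \<open>{-e<..<e}\<close>, on
    which the continuous \<open>\<rho>\<close> has an antiderivative.\<close>
  define b where "b = e / 2"
  have b: "b > 0" "{-b..b} \<subseteq> {-e<..<e}"
    using e by (auto simp: b_def)
  obtain \<sigma>0 where \<sigma>0: "\<And>x. x \<in> {-b..b} \<Longrightarrow> (\<sigma>0 has_vector_derivative \<rho> x) (at x within {-b..b})"
    using antiderivative_continuous[OF continuous_on_subset[OF \<rho>(1) b(2)]] by blast
  define \<sigma> where "\<sigma> x = \<sigma>0 x - \<sigma>0 0" for x
  have \<sigma>w: "(\<sigma> has_real_derivative \<rho> x) (at x within {-b..b})" if "x \<in> {-b..b}" for x
    using \<sigma>0[OF that] unfolding \<sigma>_def
    by (auto simp: has_real_derivative_iff_has_vector_derivative intro!: derivative_eq_intros)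
  have \<sigma>d: "(\<sigma> has_real_derivative \<rho> x) (at x)" if "x \<in> {-b<..<b}" for x
    using \<sigma>w[of x] at_within_Icc_at[of "-b" x b] that by simp
  have cont: "continuous_on {-b..b} \<sigma>"
    using \<sigma>w by (intro DERIV_continuous_on)
  have mono: "\<sigma> x < \<sigma> y" if "x \<in> {-b..b}" "y \<in> {-b..b}" "x < y" for x y
  proof (rule DERIV_pos_imp_increasing_open[OF that(3)])
    show "continuous_on {x..y} \<sigma>"
      using that by (intro continuous_on_subset[OF cont]) auto
    show "\<exists>d. (\<sigma> has_real_derivative d) (at z) \<and> 0 < d" if "x < z" "z < y" for z
      using that \<open>x \<in> _\<close> \<open>y \<in> _\<close> \<sigma>d[of z] \<rho>(2)[of z] subsetD[OF b(2), of z] by auto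
  qed
  have inj: "inj_on \<sigma> {-b..b}"
    using mono by (intro linorder_inj_onI') force
  define \<tau> where "\<tau> = the_inv_into {-b..b} \<sigma>"
  have \<tau>\<sigma>: "\<tau> (\<sigma> x) = x" if "x \<in> {-b..b}" for x
    unfolding \<tau>_def using inj that by (rule the_inv_into_f_f)
  have \<sigma>z: "\<sigma> 0 = 0"
    by (simp add: \<sigma>_def)
  \<comment> \<open>With the smaller of the two values, every \<open>s\<close> in
    \<open>{-\<delta><..<\<delta>}\<close> lies strictly between \<open>\<sigma> (-b)\<close> and
    \<open>\<sigma> b\<close>, so the intermediate value theorem finds a preimage.\<close>
  define \<delta> where "\<delta> = min (- \<sigma> (-b)) (\<sigma> b)"
  have \<delta>: "\<delta> > 0"
    using mono[of "-b" 0] mono[of 0 b] b \<sigma>z by (simp add: \<delta>_def)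
  have \<tau>: "\<tau> s \<in> {-b<..<b} \<and> \<sigma> (\<tau> s) = s" if "s \<in> {-\<delta><..<\<delta>}" for s
  proof -
    have s: "\<sigma> (-b) < s" "s < \<sigma> b"
      using that by (auto simp: \<delta>_def)
    then obtain x where x: "-b \<le> x" "x \<le> b" "\<sigma> x = s"
      using IVT'[of \<sigma> "-b" s b] cont b by auto
    moreover have "x \<noteq> -b" "x \<noteq> b"
      using s x by auto
    ultimately show ?thesis
      using \<tau>\<sigma>[of x] by auto
  qed
  have \<tau>d: "(\<tau> has_real_derivative inverse (\<rho> (\<tau> s))) (at s)" if s: "s \<in> {-\<delta><..<\<delta>}" for s
  proof (rule DERIV_inverse_function[of \<sigma> _ _ _ "-\<delta>" \<delta>])
    show "(\<sigma> has_real_derivative \<rho> (\<tau> s)) (at (\<tau> s))"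
      using \<tau>[OF s] \<sigma>d by auto
    show "\<rho> (\<tau> s) \<noteq> 0"
      using \<rho>(2)[of "\<tau> s"] \<tau>[OF s] subsetD[OF b(2), of "\<tau> s"] by auto
    define d where "d = min (\<tau> s + b) (b - \<tau> s) / 2"
    have d: "d > 0"
      using \<tau>[OF s] by (simp add: d_def)
    have dz: "z \<in> {-b<..<b}" if "\<bar>z - \<tau> s\<bar> \<le> d" for z
    proof -
      have "d \<le> (\<tau> s + b) / 2" "d \<le> (b - \<tau> s) / 2"
        by (simp_all add: d_def)
      thus ?thesis
        using that \<tau>[OF s] by (auto simp: abs_le_iff)
    qed
    have "isCont \<tau> (\<sigma> (\<tau> s))"
    proof (rule isCont_inverse_function[OF d, of "\<tau> s" \<tau> \<sigma>])
      fix z assume "\<bar>z - \<tau> s\<bar> \<le> d"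
      from dz[OF this] show "\<tau> (\<sigma> z) = z" "isCont \<sigma> z"
        using \<tau>\<sigma>[of z] DERIV_isCont[OF \<sigma>d[of z]] by auto
    qed
    thus "isCont \<tau> s"
      using \<tau>[OF s] by simp
  qed (use s \<tau> in auto)
  show thesis
  proof (rule that[OF \<delta>])
    show "\<tau> 0 = 0"
      using \<tau>\<sigma>[of 0] b \<sigma>z by simp
    fix s assume s: "s \<in> {-\<delta><..<\<delta>}"
    show *: "\<tau> s \<in> {-e<..<e}"
      using \<tau>[OF s] subsetD[OF b(2), of "\<tau> s"] by auto
    have "((\<lambda>s. \<gamma> (\<tau> s)) has_vector_derivative inverse (\<rho> (\<tau> s)) *\<^sub>R (\<rho> (\<tau> s) *\<^sub>R T (\<gamma> (\<tau> s)))) (at s)"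
      using vector_diff_chain_at[OF \<tau>d[OF s, unfolded has_real_derivative_iff_has_vector_derivative] \<gamma>[OF *]]
      by (simp add: o_def)
    thus "((\<lambda>s. \<gamma> (\<tau> s)) has_vector_derivative T (\<gamma> (\<tau> s))) (at s)"
      using \<rho>(2)[OF *] by simp
  qed
qed

text \<open>
  The inverse function theorem for the pair (coordinate along the tangent at \<open>w0\<close>, \<open>u\<close>) gives a
  regular parametrization of the level curve; after unit speed reparametrization its velocity is
  \<open>\<i> * sgn (G w)\<close>, which is differentiable because \<open>G\<close> is.
\<close>
lemma level_curve_exists:
  fixes u :: "complex \<Rightarrow> real"
  assumes \<Omega>: "open \<Omega>" "w0 \<in> \<Omega>" and G: "\<And>w. w \<in> \<Omega> \<Longrightarrow> GDERIV u w :> G w"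
    and Gd: "\<And>w. w \<in> \<Omega> \<Longrightarrow> G differentiable (at w)" and nz: "G w0 \<noteq> 0"
  obtains g a where "arclength_param_at g {w \<in> \<Omega>. u w = u w0} w0 a"
proof -
  define T where "T w = \<i> * sgn (G w)" for w
  define d where "d = T w0"
  \<comment> \<open>On \<open>U\<close> the tangent direction makes an acute angle with the one at
    \<open>w0\<close>. This excludes critical points and allows division by
    \<open>d \<bullet> T w\<close> later on.\<close>
  define U where "U = {w \<in> \<Omega>. d \<bullet> (\<i> * G w) > 0}"
  have sgn_pos: "d \<bullet> T w > 0 \<and> G w \<noteq> 0" if "w \<in> U" for w
  proof -
    have "G w \<noteq> 0" "d \<bullet> (\<i> * G w) > 0"
      using that by (auto simp: U_def)
    thus ?thesis
      by (simp add: T_def sgn_div_norm zero_less_mult_iff)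
  qed
  have contG: "continuous_on \<Omega> G"
    using Gd by (meson differentiable_imp_continuous_within continuous_at_imp_continuous_on)
  have "U = \<Omega> \<inter> (\<lambda>w. d \<bullet> (\<i> * G w)) -` {0<..}"
    by (auto simp: U_def)
  hence "open U"
    using \<Omega>(1) by (auto intro!: continuous_open_preimage continuous_intros contG)
  have "w0 \<in> U"
    using \<Omega> nz by (auto simp: U_def d_def T_def sgn_div_norm)
  have US: "U \<subseteq> \<Omega>"
    by (auto simp: U_def)
  define \<Psi> where "\<Psi> w = of_real (d \<bullet> (w - w0)) + \<i> * of_real (u w - u w0)" for w
  define D where "D w h = of_real (d \<bullet> h) + \<i> * of_real (h \<bullet> G w)" for w h
  have D: "bounded_linear (D w)" for w
    unfolding D_def
    by (intro bounded_linear_add bounded_linear_of_real[THEN bounded_linear_compose]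
        bounded_linear_const_mult bounded_linear_inner_right bounded_linear_inner_left)
  have Bapp: "blinfun_apply (Blinfun (D w)) = D w" for w
    using D by (rule bounded_linear_Blinfun_apply)
  have der: "(\<Psi> has_derivative blinfun_apply (Blinfun (D w))) (at w)" if "w \<in> U" for w
    unfolding Bapp using G[of w] that US unfolding \<Psi>_def D_def gderiv_def
    by (auto intro!: derivative_eq_intros)
  have cont: "continuous_on U (\<lambda>w. Blinfun (D w))"
    unfolding D_def[abs_def]
    by (intro continuous_on_blinfun_componentwise, unfold Bapp[unfolded D_def[abs_def]])
      (intro continuous_intros continuous_on_subset[OF contG US])
  have dn: "norm (sgn (G w0)) = 1" 
    using nz by (simp add: norm_sgn)
  \<comment> \<open>The inverse of \<open>D w0\<close>, which reads off the component along
    \<open>d\<close> and \<open>norm (G w0)\<close> times the component along the unit normal;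
    \<open>d\<close> and that normal are orthonormal.\<close>
  define E where "E y = Re y *\<^sub>R d + (Im y / norm (G w0)) *\<^sub>R sgn (G w0)" for y
  have "bounded_linear E"
    unfolding E_def
    by (intro bounded_linear_add bounded_linear_scaleR_left[THEN bounded_linear_compose]
        bounded_linear_Re bounded_linear_divide[THEN bounded_linear_compose] bounded_linear_Im)
  hence Eapp: "blinfun_apply (Blinfun E) = E"
    by (rule bounded_linear_Blinfun_apply)
  have "E (D w0 h) = h" for h
  proof -
    have "h \<bullet> sgn (G w0) = (h \<bullet> G w0) / norm (G w0)"
      by (simp add: sgn_div_norm divide_inverse mult.commute)
    thus ?thesis
      using complex_orthonormal_expansion[OF dn, of h]
      by (simp add: E_def D_def d_def T_def inner_commute)
  qed
  hence inv: "Blinfun E o\<^sub>L Blinfun (D w0) = id_blinfun"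
    by (intro blinfun_eqI) (simp add: Eapp Bapp)
  obtain U' V \<Phi> \<Phi>' where UV: "open U'" "U' \<subseteq> U" "w0 \<in> U'" "open V" "\<Psi> w0 \<in> V" "homeomorphism U' V \<Psi> \<Phi>"
      "\<And>y. y \<in> V \<Longrightarrow> (\<Phi> has_derivative (\<Phi>' y)) (at y)"
    using inverse_function_theorem[OF \<open>open U\<close> der cont \<open>w0 \<in> U\<close> inv] by metis
  have "0 \<in> V"
    using UV(5) by (simp add: \<Psi>_def)
  then obtain e where e: "e > 0" "ball 0 e \<subseteq> V"
    using UV(4) open_contains_ball by blast
  have inV: "of_real x \<in> V" if "x \<in> {-e<..<e}" for x :: real
    using that e(2) by (auto simp: subset_iff)
  define \<gamma> where "\<gamma> x = \<Phi> (of_real x)" for x :: real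
  define \<gamma>' where "\<gamma>' x = \<Phi>' (of_real x) 1" for x :: real
  have \<gamma>d: "(\<gamma> has_vector_derivative \<gamma>' x) (at x)" if "x \<in> {-e<..<e}" for x
  proof -
    have "(of_real has_vector_derivative 1) (at x)"
      by (auto simp: has_vector_derivative_def scaleR_conv_of_real intro!: derivative_eq_intros)
    from has_derivative_compose[OF this[unfolded has_vector_derivative_def] UV(7)[OF inV[OF that]]]
    show ?thesis
      using linear_scale[OF has_derivative_linear[OF UV(7)[OF inV[OF that]]]]
      by (simp add: has_vector_derivative_def \<gamma>_def[abs_def] \<gamma>'_def)
  qed
  have \<gamma>U: "\<gamma> x \<in> U" and \<Psi>\<gamma>: "\<Psi> (\<gamma> x) = of_real x" if "x \<in> {-e<..<e}" for x
    using UV(2,6) inV[OF that] by (auto simp: \<gamma>_def homeomorphism_def)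
  have u: "u (\<gamma> x) = u w0" and lin: "d \<bullet> (\<gamma> x - w0) = x" if "x \<in> {-e<..<e}" for x
    using \<Psi>\<gamma>[OF that] by (auto simp: \<Psi>_def complex_eq_iff)
  have \<gamma>0: "\<gamma> 0 = w0"
    using UV(3,6) by (simp add: \<gamma>_def homeomorphism_def) (metis \<Psi>_def add.right_neutral diff_self inner_zero_right mult_zero_right of_real_0)
  \<comment> \<open>The parameter of \<open>\<gamma>\<close> is the coordinate along
    \<open>d\<close>, so its velocity is the multiple of \<open>T\<close> whose component along
    \<open>d\<close> is 1.\<close>
  define \<rho> where "\<rho> x = 1 / (d \<bullet> T (\<gamma> x))" for x
  have \<gamma>\<rho>: "(\<gamma> has_vector_derivative \<rho> x *\<^sub>R T (\<gamma> x)) (at x)" if x: "x \<in> {-e<..<e}" for x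
  proof -
    have wU: "\<gamma> x \<in> U"
      using x by (rule \<gamma>U)
    have "((\<lambda>s. u (\<gamma> s)) has_real_derivative \<gamma>' x \<bullet> G (\<gamma> x)) (at x)"
      using x \<gamma>d wU US G by (intro has_real_derivative_along_curve) auto
    moreover have "((\<lambda>s. u (\<gamma> s)) has_real_derivative 0) (at x)"
      by (rule has_field_derivative_transform_within_open[OF DERIV_const[of "u w0"] _ x]) (use u in auto)
    ultimately have "\<gamma>' x \<bullet> G (\<gamma> x) = 0"
      by (rule DERIV_unique)
    hence "\<gamma>' x \<bullet> sgn (G (\<gamma> x)) = 0"
      by (simp add: sgn_div_norm)
    hence k: "\<gamma>' x = (\<gamma>' x \<bullet> T (\<gamma> x)) *\<^sub>R T (\<gamma> x)"
      using complex_orthonormal_expansion[of "sgn (G (\<gamma> x))" "\<gamma>' x"] sgn_pos[OF wU]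
      by (simp add: norm_sgn T_def)
    have "((\<lambda>s. d \<bullet> (\<gamma> s - w0)) has_real_derivative d \<bullet> \<gamma>' x) (at x)"
      using \<gamma>d[OF x] unfolding has_real_derivative_iff_has_vector_derivative has_vector_derivative_def
      by (auto intro!: derivative_eq_intros)
    moreover have "((\<lambda>s. d \<bullet> (\<gamma> s - w0)) has_real_derivative 1) (at x)"
      by (rule has_field_derivative_transform_within_open[OF DERIV_ident _ x]) (use lin in auto)
    ultimately have "d \<bullet> \<gamma>' x = 1"
      by (rule DERIV_unique)
    hence "(\<gamma>' x \<bullet> T (\<gamma> x)) * (d \<bullet> T (\<gamma> x)) = 1"
      using k by (metis inner_scaleR_right)
    hence "\<gamma>' x \<bullet> T (\<gamma> x) = \<rho> x"
      using sgn_pos[OF wU] by (simp add: \<rho>_def field_simps)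
    thus ?thesis
      using \<gamma>d[OF x] k by simp
  qed
  have "continuous_on {-e<..<e} \<gamma>"
    using \<gamma>d by (meson has_vector_derivative_continuous continuous_at_imp_continuous_on)
  hence "continuous_on {-e<..<e} (\<lambda>x. G (\<gamma> x))"
    using \<gamma>U US by (intro continuous_on_compose2[OF contG]) auto
  hence "continuous_on {-e<..<e} \<rho>"
    unfolding \<rho>_def T_def using sgn_pos \<gamma>U
    by (intro continuous_intros) (force simp: T_def)+
  moreover have "\<rho> x > 0" if "x \<in> {-e<..<e}" for x
    using sgn_pos[OF \<gamma>U[OF that]] by (simp add: \<rho>_def)
  ultimately obtain \<delta> \<tau> where \<delta>: "\<delta> > 0" and \<tau>0: "\<tau> 0 = 0"
      and \<tau>: "\<And>s. s \<in> {-\<delta><..<\<delta>} \<Longrightarrow> \<tau> s \<in> {-e<..<e}"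
      and g: "\<And>s. s \<in> {-\<delta><..<\<delta>} \<Longrightarrow> ((\<lambda>s. \<gamma> (\<tau> s)) has_vector_derivative T (\<gamma> (\<tau> s))) (at s)"
    using unit_speed_reparametrization[OF e(1) _ _ \<gamma>\<rho>] by metis
  \<comment> \<open>An arclength parametrization needs an acceleration only at parameter 0, hence
    differentiability of the unit tangent field only at \<open>w0\<close>.\<close>
  have "(\<lambda>w. inverse (norm (G w)) *\<^sub>R G w) differentiable (at w0)"
    using Gd[OF \<Omega>(2)] nz
    by (intro differentiable_scaleR differentiable_inverse differentiable_compose[of norm G]
        differentiable_norm_at) auto
  then obtain T' where "(T has_derivative T') (at w0)"
    unfolding T_def[abs_def] sgn_div_norm
    using has_derivative_mult_right[of _ _ _ \<i>] by (metis differentiable_def)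
  moreover have "((\<lambda>s. \<gamma> (\<tau> s)) has_derivative (\<lambda>h. h *\<^sub>R T w0)) (at 0)"
    using g[of 0] \<delta> \<gamma>0 \<tau>0 by (simp add: has_vector_derivative_def)
  ultimately have "((\<lambda>s. T (\<gamma> (\<tau> s))) has_derivative (\<lambda>h. T' (h *\<^sub>R T w0))) (at 0)"
    using has_derivative_compose \<gamma>0 \<tau>0 by metis
  hence "((\<lambda>s. T (\<gamma> (\<tau> s))) has_vector_derivative T' (T w0)) (at 0)"
    using linear_scale[OF has_derivative_linear[OF \<open>(T has_derivative T') (at w0)\<close>]]
    by (simp add: has_vector_derivative_def)
  moreover have "norm (T (\<gamma> (\<tau> s))) = 1" if "s \<in> {-\<delta><..<\<delta>}" for s
    using sgn_pos[OF \<gamma>U[OF \<tau>[OF that]]] by (simp add: T_def norm_mult norm_sgn)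
  moreover have "\<gamma> (\<tau> s) \<in> \<Omega>" "u (\<gamma> (\<tau> s)) = u w0" if "s \<in> {-\<delta><..<\<delta>}" for s
    using \<gamma>U[OF \<tau>[OF that]] US u[OF \<tau>[OF that]] by auto
  ultimately have "arclength_param_at (\<lambda>s. \<gamma> (\<tau> s)) {w \<in> \<Omega>. u w = u w0} w0 (T' (T w0))"
    unfolding arclength_param_at_def using \<delta> g \<gamma>0 \<tau>0
    by (auto intro!: exI[of _ \<delta>] exI[of _ "\<lambda>s. T (\<gamma> (\<tau> s))"])
  thus thesis
    by (rule that)
qed

text \<open>The description needs existence and uniqueness. The constructed level curve has normal
  acceleration because its speed is constant, so it has the required form for some
  \<open>\<kappa>\<close>; the normal component of the acceleration is the same for every
  parametrization.\<close>

lemma arclength_curvature_eq: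
  fixes u :: "complex \<Rightarrow> real"
  assumes \<Omega>: "open \<Omega>" "w0 \<in> \<Omega>" and G: "\<And>w. w \<in> \<Omega> \<Longrightarrow> GDERIV u w :> G w"
    and Gd: "\<And>w. w \<in> \<Omega> \<Longrightarrow> G differentiable (at w)" and nz: "G w0 \<noteq> 0"
    and G': "(G has_derivative G') (at w0)"
  defines "t \<equiv> \<i> * sgn (G w0)"
  shows "(THE \<kappa>. \<exists>g. arclength_param_at g {w \<in> \<Omega>. u w = u w0} w0 (- \<kappa> *\<^sub>R sgn (G w0)))
           = (G' t \<bullet> t) / norm (G w0)"
proof (rule the_equality)
  have curv: "a \<bullet> G w0 = - (G' t \<bullet> t)" "a \<bullet> t = 0"
    if "arclength_param_at g {w \<in> \<Omega>. u w = u w0} w0 a" for g a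
    using arclength_param_curvature[OF \<Omega>(2) G G' nz that] by (simp_all add: t_def)
  have sg: "norm (sgn (G w0)) = 1" and Gs: "G w0 = norm (G w0) *\<^sub>R sgn (G w0)"
    using nz by (simp_all add: norm_sgn sgn_div_norm)
  have "v \<bullet> G w0 = norm (G w0) * (v \<bullet> sgn (G w0))" for v
    by (subst Gs) simp
  note vG = this
  obtain g a where g: "arclength_param_at g {w \<in> \<Omega>. u w = u w0} w0 a"
    using level_curve_exists[OF \<Omega> G Gd nz] .
  have "a = (a \<bullet> sgn (G w0)) *\<^sub>R sgn (G w0)"
    using complex_orthonormal_expansion[OF sg, of a] curv(2)[OF g] by (simp add: t_def)
  moreover have "a \<bullet> sgn (G w0) = - ((G' t \<bullet> t) / norm (G w0))"
    using curv(1)[OF g] vG[of a] nz by (simp add: field_simps)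
  ultimately have "a = - ((G' t \<bullet> t) / norm (G w0)) *\<^sub>R sgn (G w0)"
    by simp
  with g show "\<exists>g. arclength_param_at g {w \<in> \<Omega>. u w = u w0} w0 (- ((G' t \<bullet> t) / norm (G w0)) *\<^sub>R sgn (G w0))"
    by metis
  fix \<kappa> assume "\<exists>g. arclength_param_at g {w \<in> \<Omega>. u w = u w0} w0 (- \<kappa> *\<^sub>R sgn (G w0))"
  then obtain g where "arclength_param_at g {w \<in> \<Omega>. u w = u w0} w0 (- \<kappa> *\<^sub>R sgn (G w0))" ..
  from curv(1)[OF this] vG[of "sgn (G w0)"] have "norm (G w0) * \<kappa> = G' t \<bullet> t"
    using sg by (simp add: norm_eq_1 mult.commute)
  thus "\<kappa> = (G' t \<bullet> t) / norm (G w0)"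
    using nz by (simp add: field_simps)
qed

subsection \<open>Convex univalent functions\<close>

lemma second_derivative_nonneg_at_min:
  fixes m :: "real \<Rightarrow> real"
  assumes m: "\<And>t. (m has_real_derivative m' t) (at t)" and m': "(m' has_real_derivative m2) (at 0)"
    and min: "\<And>t. m 0 \<le> m t"
  shows "m2 \<ge> 0"
proof (rule ccontr)
  assume "\<not> m2 \<ge> 0"
  have "m' 0 = 0"
    using DERIV_local_min[OF m, of 1 0] min by simp
  then obtain d where d: "d > 0" "\<And>h. 0 < h \<Longrightarrow> h < d \<Longrightarrow> m' h < 0"
    using DERIV_neg_dec_right[OF m'] \<open>\<not> m2 \<ge> 0\<close> by auto
  have "m (d / 2) < m 0"
  proof (rule DERIV_neg_imp_decreasing_open[of 0 "d / 2" m])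
    show "\<exists>y. (m has_real_derivative y) (at x) \<and> y < 0" if "0 < x" "x < d / 2" for x
      using m d(2)[of x] that by auto
    show "continuous_on {0..d / 2} m"
      using m by (meson DERIV_isCont continuous_at_imp_continuous_on)
  qed (use d in simp)
  thus False
    using min[of "d / 2"] by simp
qed

text \<open>
  The Schwarz lemma, applied to \<open>f\<inverse> ((1 - s) f x + s f (k x))\<close> with \<open>k = \<zeta> / z\<close>, bounds the norm of
  this self-map of the disc at \<open>x = z\<close>; the claim is its derivative at \<open>s = 0\<close>.
\<close>
lemma convex_map_pointing_inward:
  assumes f: "conformal_map_onto f \<Omega>" and conv: "convex \<Omega>"
    and z: "z \<in> ball 0 1" and \<zeta>: "norm \<zeta> \<le> norm z"
  shows "Re (cnj z * (f \<zeta> - f z) / deriv f z) \<le> 0"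
proof (cases "z = 0")
  case False
  obtain F where F: "open \<Omega>" "F holomorphic_on \<Omega>" "F ` \<Omega> \<subseteq> ball 0 1"
      "\<And>z. z \<in> ball 0 1 \<Longrightarrow> F (f z) = z"
      "\<And>w. w \<in> \<Omega> \<Longrightarrow> (F has_field_derivative 1 / deriv f (F w)) (at w)"
    using conformal_map_inverse[OF f] by metis
  have fh: "f holomorphic_on ball 0 1" and fim: "f ` ball 0 1 = \<Omega>"
    using f by (auto simp: conformal_map_onto_def)
  define k where "k = \<zeta> / z"
  have k: "norm k \<le> 1" "\<zeta> = k * z"
    using \<zeta> False by (auto simp: k_def norm_divide divide_le_eq)
  have kb: "k * x \<in> ball 0 1" if "x \<in> ball 0 1" for x
    using k(1) that mult_left_le_one_le[of "norm x" "norm k"] by (auto simp: norm_mult)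
  define \<psi> where "\<psi> s = F (f z + of_real s * (f \<zeta> - f z))" for s :: real
  have le: "norm (\<psi> s) \<le> norm z" if s: "0 \<le> s" "s \<le> 1" for s
  proof -
    let ?h = "\<lambda>x. (1 - s) *\<^sub>R f x + s *\<^sub>R f (k * x)"
    have hin: "?h x \<in> \<Omega>" if "x \<in> ball 0 1" for x
      using s that kb[OF that] fim by (intro convexD[OF conv]) auto
    have "(\<lambda>x. f (k * x)) holomorphic_on ball 0 1"
      using kb by (intro holomorphic_on_compose_gen[OF _ fh, unfolded o_def] holomorphic_intros) auto
    hence "?h holomorphic_on ball 0 1"
      using fh unfolding scaleR_conv_of_real by (intro holomorphic_intros)
    hence "(\<lambda>x. F (?h x)) holomorphic_on ball 0 1"
      using hin by (intro holomorphic_on_compose_gen[OF _ F(2), unfolded o_def]) auto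
    moreover have "F (?h 0) = 0"
      using F(4)[of 0] by (simp flip: scaleR_add_left)
    moreover have "norm (F (?h x)) < 1" if "norm x < 1" for x
      using hin[of x] that F(3) by (force simp: image_subset_iff)
    ultimately have "norm (F (?h z)) \<le> norm z"
      using z by (intro Schwarz_Lemma(1)) auto
    thus ?thesis
      by (simp add: \<psi>_def k(2) scaleR_conv_of_real algebra_simps)
  qed
  have \<psi>0: "\<psi> 0 = z"
    using z F(4) by (simp add: \<psi>_def)
  have fz: "f z \<in> \<Omega>"
    using z fim by auto
  define v where "v = (f \<zeta> - f z) / deriv f z"
  have "((\<lambda>s. F (f z + s * (f \<zeta> - f z))) has_field_derivative 1 / deriv f z * (f \<zeta> - f z)) (at (of_real 0))"
    using F(5)[OF fz] F(4)[OF z] by (intro DERIV_chain2[of F]) (auto intro!: derivative_eq_intros)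
  hence "(\<psi> has_vector_derivative v) (at 0)"
    unfolding \<psi>_def v_def by (intro has_vector_derivative_real_field) simp
  hence "((\<lambda>s. \<psi> s \<bullet> \<psi> s) has_real_derivative 2 * (z \<bullet> v)) (at 0)"
    unfolding has_real_derivative_iff_has_vector_derivative has_vector_derivative_def
    by (auto intro!: derivative_eq_intros simp: \<psi>0 inner_commute)
  note der = this
  have "z \<bullet> v \<le> 0"
  proof (rule ccontr)
    assume "\<not> z \<bullet> v \<le> 0"
    hence "0 < 2 * (z \<bullet> v)"
      by simp
    from DERIV_pos_inc_right[OF der this]
    obtain d where d: "d > 0" "\<And>h. 0 < h \<Longrightarrow> h < d \<Longrightarrow> \<psi> 0 \<bullet> \<psi> 0 < \<psi> h \<bullet> \<psi> h"
      by auto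
    have "norm (\<psi> 0) < norm (\<psi> (min (d / 2) 1))"
      using d(2)[of "min (d / 2) 1"] d(1) by (simp add: norm_eq_sqrt_inner)
    thus False
      using le[of "min (d / 2) 1"] d(1) \<psi>0 by simp
  qed
  moreover have "z \<bullet> v = Re (cnj z * v)"
    by (simp add: inner_complex_def)
  ultimately show ?thesis
    by (simp add: v_def)
qed simp

text \<open>By \<open>convex_map_pointing_inward\<close>, \<open>Re (H t)\<close> is minimal at
  \<open>t = 0\<close> along the circle through \<open>z\<close>: the image of the circle stays on
  one side of its tangent at \<open>f z\<close>. The second derivative of \<open>H\<close> at 0 is
  \<open>|z|^2 (1 + z f'' / f')\<close>.\<close>

lemma convex_map_Re_nonneg:
  assumes f: "conformal_map_onto f \<Omega>" and conv: "convex \<Omega>" and z: "z \<in> ball 0 1"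
  shows "Re (1 + z * deriv (deriv f) z / deriv f z) \<ge> 0"
proof (cases "z = 0")
  case False
  have fh: "f holomorphic_on ball 0 1"
    using f by (auto simp: conformal_map_onto_def)
  have nz: "deriv f z \<noteq> 0"
    using conformal_map_inverse[OF f] z by metis
  define k where "k = cnj z / deriv f z"
  define H where "H t = - (k * f (z * exp (\<i> * t)))" for t
  define H' where "H' t = - (k * (deriv f (z * exp (\<i> * t)) * (z * (exp (\<i> * t) * \<i>))))" for t
  have inb: "z * exp (\<i> * of_real t) \<in> ball 0 1" for t
    using z by (simp add: norm_mult)
  note fd = holomorphic_derivI[OF fh open_ball] holomorphic_derivI[OF holomorphic_deriv[OF fh open_ball] open_ball]
  have e': "((\<lambda>t. z * exp (\<i> * t)) has_field_derivative z * (exp (\<i> * t) * \<i>)) (at t)" for t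
    by (auto intro!: derivative_eq_intros)
  have H: "(H has_field_derivative H' (of_real t)) (at (of_real t))" for t
    unfolding H_def H'_def
    by (intro DERIV_minus DERIV_cmult DERIV_chain2[of f] fd(1) inb e')
  have H': "(H' has_field_derivative k * (deriv (deriv f) z * z\<^sup>2 + deriv f z * z)) (at (of_real 0))"
  proof -
    have "((\<lambda>t. deriv f (z * exp (\<i> * t))) has_field_derivative deriv (deriv f) z * (z * \<i>)) (at 0)"
      using DERIV_chain2[OF _ e'[of 0], of "deriv f"] fd(2)[OF z] by simp
    thus ?thesis
      unfolding H'_def by (auto intro!: derivative_eq_intros simp: power2_eq_square algebra_simps)
  qed
  have "Re (k * (deriv (deriv f) z * z\<^sup>2 + deriv f z * z)) \<ge> 0"
  proof (rule second_derivative_nonneg_at_min)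
    show "((\<lambda>t. Re (H (of_real t))) has_real_derivative Re (H' (of_real t))) (at t)" for t
      by (intro has_field_derivative_Re has_vector_derivative_real_field H)
    show "((\<lambda>t. Re (H' (of_real t))) has_real_derivative Re (k * (deriv (deriv f) z * z\<^sup>2 + deriv f z * z))) (at 0)"
      by (intro has_field_derivative_Re has_vector_derivative_real_field H')
    show "Re (H (of_real 0)) \<le> Re (H (of_real t))" for t
    proof -
      have "Re (cnj z * (f (z * exp (\<i> * of_real t)) - f z) / deriv f z) \<le> 0"
        by (intro convex_map_pointing_inward[OF f conv z]) (simp add: norm_mult)
      also have "cnj z * (f (z * exp (\<i> * of_real t)) - f z) / deriv f z = H (of_real 0) - H (of_real t)"
        by (simp add: H_def k_def diff_divide_distrib right_diff_distrib)
      finally show ?thesis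
        by simp
    qed
  qed
  also have "k * (deriv (deriv f) z * z\<^sup>2 + deriv f z * z)
      = of_real ((norm z)\<^sup>2) * (1 + z * deriv (deriv f) z / deriv f z)"
    unfolding complex_norm_square using nz by (simp add: k_def field_simps power2_eq_square)
  finally have "0 \<le> (norm z)\<^sup>2 * Re (1 + z * deriv (deriv f) z / deriv f z)"
    unfolding times_complex.sel Re_complex_of_real Im_complex_of_real by simp
  thus ?thesis
    using False by (simp add: zero_le_mult_iff)
qed simp

section \<open>Schwarz-Pick at the centre and its equality case\<close>

lemma norm_less_1_of_le_1:
  fixes f :: "complex \<Rightarrow> complex"
  assumes "f holomorphic_on ball 0 1" "f 0 = 0" "\<And>z. z \<in> ball 0 1 \<Longrightarrow> norm (f z) \<le> 1"
    and z: "norm z < 1"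
  shows "norm (f z) < 1"
proof -
  \<comment> \<open>Scaling by \<open>r < 1\<close> moves the values into the open disc, as the
    Schwarz lemma demands; since \<open>r\<close> is arbitrary, the bound passes to \<open>f\<close>
    itself.\<close>
  have "r * norm (f z) \<le> norm z" if r: "0 < r" "r < 1" for r
  proof -
    have "norm (of_real r * f w) < 1" if "norm w < 1" for w
      using r assms(3)[of w] that by (simp add: norm_mult) (smt (verit) mult_left_le)
    hence "norm (of_real r * f z) \<le> norm z"
      using assms by (intro Schwarz_Lemma(1)) (auto intro!: holomorphic_intros)
    thus ?thesis
      using r by (simp add: norm_mult)
  qed
  hence "norm (f z) \<le> norm z"
    by (rule field_le_mult_one_interval)
  thus ?thesis
    using z by simp
qed

text \<open>Composing \<open>\<phi>\<close> with the disc automorphism that takes \<open>p\<close>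
  to 0 gives \<open>\<tau>\<close>, which fixes 0 with derivative \<open>q / (1 - |p|^2)\<close>.
  Equality forces this derivative to be \<open>- (sgn p)\<^sup>2\<close>, of modulus 1; then
  \<open>\<tau>\<close> is a rotation, and solving for \<open>\<phi>\<close> gives the second claim,
  written without division.\<close>

lemma Schwarz_Pick_at_0:
  assumes \<phi>: "\<phi> holomorphic_on ball 0 1" and le: "\<And>z. z \<in> ball 0 1 \<Longrightarrow> norm (\<phi> z) \<le> 1"
    and nz: "\<phi> 0 \<noteq> 0"
  defines "p \<equiv> \<phi> 0" and "q \<equiv> deriv \<phi> 0"
  shows "Re (q * (cnj p)\<^sup>2) \<ge> - (norm p)\<^sup>2 * (1 - (norm p)\<^sup>2)"
    and "Re (q * (cnj p)\<^sup>2) = - (norm p)\<^sup>2 * (1 - (norm p)\<^sup>2) \<Longrightarrow> z \<in> ball 0 1 \<Longrightarrow>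
           \<phi> z * (1 - p * z) = p - (sgn p)\<^sup>2 * z"
proof -
  have p1: "norm p \<le> 1"
    using le[of 0] by (simp add: p_def)
  have sg: "norm (sgn p) = 1" "p = norm p * sgn p"
    using nz by (simp_all add: p_def norm_sgn) (simp add: sgn_div_norm scaleR_conv_of_real)
  have cp: "cnj p = norm p * cnj (sgn p)"
    using arg_cong[OF sg(2), of cnj] by simp
  have ss: "cnj (sgn p) * sgn p = 1"
    using complex_norm_square[of "sgn p"] sg(1) by (simp add: mult.commute)
  have "Re (q * (cnj p)\<^sup>2) \<ge> - (norm p)\<^sup>2 * (1 - (norm p)\<^sup>2) \<and>
     (Re (q * (cnj p)\<^sup>2) = - (norm p)\<^sup>2 * (1 - (norm p)\<^sup>2) \<longrightarrow> (\<forall>z\<in>ball 0 1.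
           \<phi> z * (1 - p * z) = p - (sgn p)\<^sup>2 * z))"
  proof (cases "norm p = 1")
    \<comment> \<open>Here the automorphism would degenerate. The maximum principle makes
      \<open>\<phi>\<close> constant instead, and equality holds.\<close>
    case True
    have "\<phi> constant_on ball 0 1"
      by (rule maximum_modulus_principle[OF \<phi> open_ball connected_ball open_ball order_refl, of 0])
        (use le True in \<open>auto simp: p_def\<close>)
    then obtain c where c: "\<And>z. z \<in> ball 0 1 \<Longrightarrow> \<phi> z = c"
      by (auto simp: constant_on_def)
    hence cp: "\<phi> z = p" if "z \<in> ball 0 1" for z
      using that by (simp add: p_def)
    have "(\<phi> has_field_derivative 0) (at 0)"
      by (rule has_field_derivative_transform_within_open[OF DERIV_const[of p] open_ball, of 0 0 1])
        (use cp in auto)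
    hence "q = 0"
      by (simp add: q_def DERIV_imp_deriv)
    moreover have "sgn p = p"
      using True by (simp add: sgn_div_norm)
    ultimately show ?thesis
      using True cp by (simp add: algebra_simps power2_eq_square)
  next
    case False
    hence p1: "norm p < 1"
      using p1 by simp
    have pn: "(norm p)\<^sup>2 < 1"
      using p1 by (simp add: power_less_one_iff)
    have den: "1 - cnj p * \<phi> z \<noteq> 0" if "z \<in> ball 0 1" for z
    proof -
      have "norm (cnj p * \<phi> z) < 1"
        using p1 le[OF that] by (simp add: norm_mult) (smt (verit) mult_left_le norm_ge_zero)
      thus ?thesis
        by auto
    qed
    define \<tau> where "\<tau> z = (\<phi> z - p) / (1 - cnj p * \<phi> z)" for z
    have \<tau>h: "\<tau> holomorphic_on ball 0 1"
      unfolding \<tau>_def using den by (intro holomorphic_intros \<phi>) auto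
    have \<tau>0: "\<tau> 0 = 0"
      by (simp add: \<tau>_def p_def)
    have \<tau>le: "norm (\<tau> z) \<le> 1" if z: "z \<in> ball 0 1" for z
    proof -
      have "(norm (1 - cnj p * \<phi> z))\<^sup>2 - (norm (\<phi> z - p))\<^sup>2 = (1 - (norm p)\<^sup>2) * (1 - (norm (\<phi> z))\<^sup>2)"
        unfolding cmod_power2 by (simp add: power2_eq_square algebra_simps)
      moreover have "(1 - (norm p)\<^sup>2) * (1 - (norm (\<phi> z))\<^sup>2) \<ge> 0"
        using pn le[OF z] by (intro mult_nonneg_nonneg) (auto simp: power_le_one)
      ultimately have "(norm (\<phi> z - p))\<^sup>2 \<le> (norm (1 - cnj p * \<phi> z))\<^sup>2"
        by linarith
      hence "norm (\<phi> z - p) \<le> norm (1 - cnj p * \<phi> z)"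
        by (rule power2_le_imp_le) simp
      thus ?thesis
        using den[OF z] by (simp add: \<tau>_def norm_divide)
    qed
    have lt: "norm (\<tau> z) < 1" if "norm z < 1" for z
      using norm_less_1_of_le_1[OF \<tau>h \<tau>0 \<tau>le that] by simp
    define a where "a = deriv \<tau> 0"
    have a1: "norm a \<le> 1"
      unfolding a_def using Schwarz_Lemma(2)[OF \<tau>h \<tau>0 lt, of 0] by simp
    have pp: "cnj p * p = of_real ((norm p)\<^sup>2)"
      by (simp add: complex_norm_square mult.commute flip: of_real_power)
    have nz1: "1 - (of_real ((norm p)\<^sup>2) :: complex) \<noteq> 0"
      using pn by (metis eq_iff_diff_eq_0 less_irrefl of_real_1 of_real_eq_iff)
    have "(\<tau> has_field_derivative q / (1 - of_real ((norm p)\<^sup>2))) (at 0)"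
      unfolding \<tau>_def q_def
      using holomorphic_derivI[OF \<phi> open_ball, of 0] den[of 0] nz1
      by (auto intro!: derivative_eq_intros simp: pp simp flip: p_def)
    hence qa: "q = a * of_real (1 - (norm p)\<^sup>2)"
      using nz1 by (simp add: a_def DERIV_imp_deriv)
    \<comment> \<open>Rotating by the direction of \<open>p\<close> turns the quantity into a
      nonnegative multiple of \<open>Re b\<close>. As \<open>norm b \<le> 1\<close>,
      \<open>Re b = -1\<close> is possible only for \<open>b = -1\<close>.\<close>
    define b where "b = a * (cnj (sgn p))\<^sup>2"
    have b1: "norm b \<le> 1"
      using a1 sg by (simp add: b_def norm_mult norm_power)
    have "q * (cnj p)\<^sup>2 = of_real ((1 - (norm p)\<^sup>2) * (norm p)\<^sup>2) * b"
      unfolding qa b_def cp by (simp add: power_mult_distrib mult_ac)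
    hence Reb: "Re (q * (cnj p)\<^sup>2) = (1 - (norm p)\<^sup>2) * (norm p)\<^sup>2 * Re b"
      by simp
    have "Re b \<ge> -1"
      using abs_Re_le_cmod[of b] b1 by linarith
    hence "(1 - (norm p)\<^sup>2) * (norm p)\<^sup>2 * Re b \<ge> (1 - (norm p)\<^sup>2) * (norm p)\<^sup>2 * (-1)"
      using pn by (intro mult_left_mono) auto
    moreover have "\<phi> z * (1 - p * z) = p - (sgn p)\<^sup>2 * z"
      if eq: "Re (q * (cnj p)\<^sup>2) = - (norm p)\<^sup>2 * (1 - (norm p)\<^sup>2)" and z: "z \<in> ball 0 1" for z
    proof -
      have "((1 - (norm p)\<^sup>2) * (norm p)\<^sup>2) * (Re b + 1) = 0"
        using eq Reb by (simp add: algebra_simps)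
      hence "Re b = -1"
        using pn nz by (auto simp: p_def)
      hence "b = -1"
        using b1 by (simp add: complex_eq_iff cmod_def)
      moreover have "b * (sgn p)\<^sup>2 = a * (cnj (sgn p) * sgn p)\<^sup>2"
        by (simp add: b_def power_mult_distrib)
      ultimately have a: "a = - (sgn p)\<^sup>2"
        by (simp add: ss)
      hence "norm a = 1"
        using sg by (simp add: norm_power)
      then obtain \<alpha> where \<alpha>: "\<And>z. norm z < 1 \<Longrightarrow> \<tau> z = \<alpha> * z"
        using Schwarz_Lemma(3)[OF \<tau>h \<tau>0 lt, of 0] by (auto simp: a_def)
      have "(\<tau> has_field_derivative \<alpha>) (at 0)"
        by (rule has_field_derivative_transform_within_open[OF _ open_ball, of "\<lambda>z. \<alpha> * z" _ 0 0 1])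
          (use \<alpha> in \<open>auto intro!: derivative_eq_intros\<close>)
      hence "\<alpha> = - (sgn p)\<^sup>2"
        using a by (simp add: a_def DERIV_imp_deriv)
      hence "\<phi> z - p = - (sgn p)\<^sup>2 * z * (1 - cnj p * \<phi> z)"
        using \<alpha>[of z] z den[OF z] by (simp add: \<tau>_def divide_eq_eq)
      moreover have "(sgn p)\<^sup>2 * cnj p = p"
      proof -
        have "(sgn p)\<^sup>2 * cnj p = norm p * (cnj (sgn p) * sgn p) * sgn p"
          by (simp add: cp power2_eq_square)
        thus ?thesis
          unfolding ss using sg(2) by simp
      qed
      ultimately show ?thesis
        by algebra
    qed
    ultimately show ?thesis
      using Reb by (simp add: mult.commute)
  qed
  thus "Re (q * (cnj p)\<^sup>2) \<ge> - (norm p)\<^sup>2 * (1 - (norm p)\<^sup>2)"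
    and "Re (q * (cnj p)\<^sup>2) = - (norm p)\<^sup>2 * (1 - (norm p)\<^sup>2) \<Longrightarrow> z \<in> ball 0 1 \<Longrightarrow>
           \<phi> z * (1 - p * z) = p - (sgn p)\<^sup>2 * z"
    by auto
qed

text \<open>With \<open>p = 2 \<phi>(0)\<close> and
  \<open>p' = 2 \<phi>'(0) + 2 \<phi>(0)^2\<close>, the expression becomes 8 times the difference of
  the two sides in \<open>Schwarz_Pick_at_0\<close>, so both its sign and its equality case are
  inherited.\<close>

lemma convex_map_second_order:
  assumes f: "conformal_map_onto f \<Omega>" and conv: "convex \<Omega>"
  defines "P \<equiv> \<lambda>z. deriv (deriv f) z / deriv f z"
  defines "p \<equiv> P 0" and "p' \<equiv> deriv P 0"
  assumes nz: "p \<noteq> 0"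
  shows "2 * (norm p)\<^sup>2 + Re ((p' - p\<^sup>2) * (cnj p)\<^sup>2) \<ge> 0"
    and "2 * (norm p)\<^sup>2 + Re ((p' - p\<^sup>2) * (cnj p)\<^sup>2) = 0 \<Longrightarrow>
           \<exists>r e. 0 < r \<and> r \<le> 1 \<and> norm e = 1 \<and>
             (\<forall>z\<in>ball 0 1. deriv f z * (1 - 2 * of_real r * e * z + e\<^sup>2 * z\<^sup>2) = deriv f 0)"
proof -
  have fh: "f holomorphic_on ball 0 1"
    using f by (auto simp: conformal_map_onto_def)
  have f'nz: "deriv f z \<noteq> 0" if "z \<in> ball 0 1" for z
    using conformal_map_inverse[OF f] that by metis
  have f'h: "deriv f holomorphic_on ball 0 1"
    using fh by (intro holomorphic_deriv) auto
  have Ph: "P holomorphic_on ball 0 1"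
    unfolding P_def using f'nz f'h fh by (intro holomorphic_intros holomorphic_deriv) auto
  have Re: "Re (1 + z * P z) \<ge> 0" if "z \<in> ball 0 1" for z
    using convex_map_Re_nonneg[OF f conv that] by (simp add: P_def)
  have den: "2 + z * P z \<noteq> 0" if "z \<in> ball 0 1" for z
    using Re[OF that] by (auto simp: complex_eq_iff)
  define \<phi> where "\<phi> z = P z / (2 + z * P z)" for z
  have \<phi>h: "\<phi> holomorphic_on ball 0 1"
    unfolding \<phi>_def using den by (intro holomorphic_intros Ph) auto
  have P\<phi>: "P z * (1 - z * \<phi> z) = 2 * \<phi> z" if "z \<in> ball 0 1" for z
    using den[OF that] by (simp add: \<phi>_def field_simps)
  let ?w = "\<lambda>z. z * \<phi> z"
  have wh: "?w holomorphic_on ball 0 1"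
    by (intro holomorphic_intros \<phi>h)
  have "norm (?w z) \<le> 1" if z: "z \<in> ball 0 1" for z
  proof -
    have "(norm (2 + z * P z))\<^sup>2 - (norm (z * P z))\<^sup>2 = 4 * Re (1 + z * P z)"
      unfolding cmod_power2 by (simp add: power2_eq_square algebra_simps)
    hence "(norm (z * P z))\<^sup>2 \<le> (norm (2 + z * P z))\<^sup>2"
      using Re[OF z] by linarith
    hence "norm (z * P z) \<le> norm (2 + z * P z)"
      by (rule power2_le_imp_le) simp
    thus ?thesis
      using den[OF z] by (simp add: \<phi>_def norm_divide norm_mult)
  qed
  note wlt = norm_less_1_of_le_1[OF wh _ this, simplified]
  have dw: "deriv ?w 0 = \<phi> 0"
    using holomorphic_derivI[OF \<phi>h open_ball, of 0]
    by (intro DERIV_imp_deriv) (auto intro!: derivative_eq_intros)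
  have \<phi>le: "norm (\<phi> z) \<le> 1" if z: "z \<in> ball 0 1" for z
  proof (cases "z = 0")
    case True
    thus ?thesis
      using Schwarz_Lemma(2)[OF wh _ wlt, of 0] dw by simp
  next
    case False
    have "norm (?w z) \<le> norm z"
      using z wlt by (intro Schwarz_Lemma(1)[OF wh]) auto
    thus ?thesis
      using False by (simp add: norm_mult)
  qed
  have p\<phi>: "p = 2 * \<phi> 0"
    by (simp add: p_def \<phi>_def)
  have "(\<phi> has_field_derivative p' / 2 - (\<phi> 0)\<^sup>2) (at 0)"
    unfolding \<phi>_def p'_def using holomorphic_derivI[OF Ph open_ball, of 0]
    by (auto intro!: derivative_eq_intros simp: field_simps power2_eq_square)
  hence p'\<phi>: "p' = 2 * deriv \<phi> 0 + 2 * (\<phi> 0)\<^sup>2"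
    by (simp add: DERIV_imp_deriv)
  have \<phi>0: "\<phi> 0 \<noteq> 0"
    using nz p\<phi> by simp
  note SP = Schwarz_Pick_at_0[OF \<phi>h \<phi>le \<phi>0]
  define L where "L = Re (deriv \<phi> 0 * (cnj (\<phi> 0))\<^sup>2)"
  have "\<phi> 0 * cnj (\<phi> 0) = of_real ((norm (\<phi> 0))\<^sup>2)"
    by (rule complex_norm_square[symmetric])
  hence "(p' - p\<^sup>2) * (cnj p)\<^sup>2 = 8 * (deriv \<phi> 0 * (cnj (\<phi> 0))\<^sup>2) - 8 * of_real (((norm (\<phi> 0))\<^sup>2)\<^sup>2)"
    unfolding p'\<phi> p\<phi> of_real_power[of "(norm (\<phi> 0))\<^sup>2"]
    by (simp add: algebra_simps power2_eq_square[of "_ * _"] flip: power_mult_distrib) algebra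
  hence "Re ((p' - p\<^sup>2) * (cnj p)\<^sup>2) = 8 * L - 8 * ((norm (\<phi> 0))\<^sup>2)\<^sup>2"
    by (simp add: L_def)
  hence key: "2 * (norm p)\<^sup>2 + Re ((p' - p\<^sup>2) * (cnj p)\<^sup>2)
      = 8 * (L + (norm (\<phi> 0))\<^sup>2 * (1 - (norm (\<phi> 0))\<^sup>2))"
    by (simp add: p\<phi> norm_mult power_mult_distrib algebra_simps power2_eq_square)
  show "2 * (norm p)\<^sup>2 + Re ((p' - p\<^sup>2) * (cnj p)\<^sup>2) \<ge> 0"
    unfolding key using SP(1) by (simp add: L_def)
  assume "2 * (norm p)\<^sup>2 + Re ((p' - p\<^sup>2) * (cnj p)\<^sup>2) = 0"
  hence "L = - (norm (\<phi> 0))\<^sup>2 * (1 - (norm (\<phi> 0))\<^sup>2)"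
    unfolding key by simp
  hence eq: "\<phi> z * (1 - \<phi> 0 * z) = \<phi> 0 - (sgn (\<phi> 0))\<^sup>2 * z" if "z \<in> ball 0 1" for z
    using SP(2)[OF _ _ that] by (simp add: L_def)
  define e where "e = sgn (\<phi> 0)"
  define r where "r = norm (\<phi> 0)"
  have re: "\<phi> 0 = of_real r * e"
    using \<phi>0 by (simp add: r_def e_def sgn_div_norm scaleR_conv_of_real)
  \<comment> \<open>The explicit \<open>\<phi>\<close> of the equality case makes
    \<open>P = - q' / q\<close>, so \<open>deriv f * q\<close> has derivative zero. The zeros of
    \<open>q\<close> are \<open>cnj e * (r + \<i> s)\<close> and \<open>cnj e * (r - \<i> s)\<close>
    with \<open>s^2 = 1 - r^2\<close>, on the unit circle.\<close>
  define q where "q z = 1 - 2 * of_real r * e * z + e\<^sup>2 * z\<^sup>2" for z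
  have deq: "((\<lambda>z. deriv f z * q z) has_field_derivative 0) (at z within ball 0 1)" if z: "z \<in> ball 0 1" for z
  proof -
    have "P z * q z = - (- 2 * of_real r * e + 2 * e\<^sup>2 * z)"
      using eq[OF z] P\<phi>[OF z] unfolding e_def[symmetric] unfolding re q_def by algebra
    hence "deriv (deriv f) z * q z = - (- 2 * of_real r * e + 2 * e\<^sup>2 * z) * deriv f z"
      using f'nz[OF z] by (simp add: P_def field_simps)
    moreover have "(deriv f has_field_derivative deriv (deriv f) z) (at z within ball 0 1)"
      using holomorphic_derivI[OF f'h open_ball z] .
    ultimately show ?thesis
      unfolding q_def by (auto intro!: derivative_eq_intros simp: algebra_simps)
  qed
  obtain k where k: "\<And>z. z \<in> ball 0 1 \<Longrightarrow> deriv f z * q z = k"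
    using has_field_derivative_zero_constant[OF convex_ball deq] by blast
  have "deriv f z * q z = deriv f 0" if "z \<in> ball 0 1" for z
    using k[OF that] k[of 0] by (simp add: q_def)
  thus "\<exists>r e. 0 < r \<and> r \<le> 1 \<and> norm e = 1 \<and>
      (\<forall>z\<in>ball 0 1. deriv f z * (1 - 2 * of_real r * e * z + e\<^sup>2 * z\<^sup>2) = deriv f 0)"
    using \<phi>0 \<phi>le[of 0] unfolding q_def
    by (intro exI[of _ r] exI[of _ e]) (simp add: r_def e_def norm_sgn)
qed

text \<open>
  The preimage of the line is the solution of \<open>z' = \<i> cnj e (1 - 2 r e z + e\<^sup>2 z\<^sup>2)\<close>, \<open>z 0 = 0\<close>,
  namely \<open>cnj e S / (r S - \<i> C)\<close> with \<open>S t = sinh (s t) / s\<close>, \<open>C t = cosh (s t)\<close> and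
  \<open>s\<^sup>2 = 1 - r\<^sup>2\<close> (\<open>S t = t\<close>, \<open>C t = 1\<close> if \<open>s = 0\<close>).
\<close>
lemma image_contains_line:
  assumes f: "f holomorphic_on ball 0 1" and r: "0 < r" "r \<le> 1" and e: "norm e = 1"
    and ode: "\<And>z. z \<in> ball 0 1 \<Longrightarrow> deriv f z * (1 - 2 * of_real r * e * z + e\<^sup>2 * z\<^sup>2) = c"
  shows "f 0 + of_real t * (\<i> * c * cnj e) \<in> f ` ball 0 1"
proof -
  define s where "s = sqrt (1 - r\<^sup>2)"
  have "r\<^sup>2 \<le> 1"
    using r by (simp add: power_le_one)
  hence s: "s\<^sup>2 = 1 - r\<^sup>2"
    by (simp add: s_def)
  \<comment> \<open>Complex arguments permit the holomorphic chain rule with \<open>f\<close>; the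
    real counterparts \<open>S'\<close> and \<open>C'\<close> serve the norm estimates. The rest of
    the proof treats \<open>s = 0\<close> and \<open>s \<noteq> 0\<close> alike.\<close>
  obtain S C :: "complex \<Rightarrow> complex" and S' C' :: "real \<Rightarrow> real"
    where S: "\<And>t. (S has_field_derivative C t) (at t)"
      and C: "\<And>t. (C has_field_derivative of_real (s\<^sup>2) * S t) (at t)"
      and S': "\<And>t. S (of_real t) = of_real (S' t)" and C': "\<And>t. C (of_real t) = of_real (C' t)"
      and CS: "\<And>t. (C' t)\<^sup>2 - s\<^sup>2 * (S' t)\<^sup>2 = 1" and S0: "S 0 = 0"
  proof (cases "s = 0")
    case True
    show thesis
      by (rule that[of "\<lambda>t. t" "\<lambda>t. 1" "\<lambda>t. t" "\<lambda>t. 1"]) (auto simp: True intro!: derivative_eq_intros)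
  next
    case False
    show thesis
    proof (rule that[of "\<lambda>t. sinh (of_real s * t) / of_real s" "\<lambda>t. cosh (of_real s * t)"
          "\<lambda>t. sinh (s * t) / s" "\<lambda>t. cosh (s * t)"])
      show "((\<lambda>t. sinh (of_real s * t) / of_real s) has_field_derivative cosh (of_real s * t)) (at t)"
        for t :: complex
        using False by (auto intro!: derivative_eq_intros)
      show "((\<lambda>t. cosh (of_real s * t)) has_field_derivative
          of_real (s\<^sup>2) * (sinh (of_real s * t) / of_real s)) (at t)" for t :: complex
        using False by (auto intro!: derivative_eq_intros simp: power2_eq_square)
      show "(cosh (s * t))\<^sup>2 - s\<^sup>2 * (sinh (s * t) / s)\<^sup>2 = 1" for t
        using False by (simp add: power_divide cosh_square_eq)
      have "sinh (of_real x :: complex) = of_real (sinh x)" "cosh (of_real x :: complex) = of_real (cosh x)" for x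
        by (simp_all add: sinh_field_def cosh_field_def exp_of_real flip: of_real_minus)
      thus "sinh (of_real s * of_real t :: complex) / of_real s = of_real (sinh (s * t) / s)"
        "cosh (of_real s * of_real t :: complex) = of_real (cosh (s * t))" for t
        by (simp_all flip: of_real_mult)
    qed simp
  qed
  define D where "D t = of_real r * S t - \<i> * C t" for t
  have CS': "(C (of_real t))\<^sup>2 - of_real (s\<^sup>2) * (S (of_real t))\<^sup>2 = 1" for t
    using arg_cong[OF CS[of t], of complex_of_real] by (simp add: S' C')
  have C'pos: "(C' t)\<^sup>2 > 0" for t
    using CS[of t] by (smt (verit) zero_le_power2 mult_nonneg_nonneg)
  have nD: "(norm (D (of_real t)))\<^sup>2 = r\<^sup>2 * (S' t)\<^sup>2 + (C' t)\<^sup>2" for t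
    unfolding cmod_power2 D_def S' C' by (simp add: power_mult_distrib)
  have Dnz: "D (of_real t) \<noteq> 0" for t
    using nD[of t] C'pos[of t] by (auto simp: add_nonneg_eq_0_iff)
  define z where "z t = cnj e * (S t / D t)" for t
  have zin: "z (of_real t) \<in> ball 0 1" for t
  proof -
    have "(norm (D (of_real t)))\<^sup>2 = (S' t)\<^sup>2 + 1"
      unfolding nD using CS[of t] s by (simp add: algebra_simps)
    hence "(norm (S (of_real t)))\<^sup>2 < (norm (D (of_real t)))\<^sup>2"
      by (simp add: S')
    hence "norm (S (of_real t)) < norm (D (of_real t))"
      by (rule power2_less_imp_less) simp
    thus ?thesis
      using e Dnz[of t] by (simp add: z_def norm_mult norm_divide)
  qed
  have ee: "e * cnj e = 1"
    using complex_norm_square[of e] e by simp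
  \<comment> \<open>The field \<open>\<i> cnj e - 2 \<i> r z + \<i> e z^2\<close> is tangent to the
    unit circle and generates disc automorphisms; this is the reason for the factor
    \<open>\<i> * cnj e\<close> and why the solution exists for all times. By \<open>ode\<close>,
    \<open>f\<close> carries the field to the constant \<open>v\<close>.\<close>
  define v where "v = \<i> * c * cnj e"
  have "((\<lambda>t. f (z (of_real t)) - of_real t * v) has_vector_derivative 0) (at t)" for t
  proof -
    let ?t = "complex_of_real t"
    let ?q = "1 - 2 * of_real r * e * z ?t + e\<^sup>2 * (z ?t)\<^sup>2"
    have num: "C ?t * D ?t - S ?t * (of_real r * C ?t - \<i> * (of_real (s\<^sup>2) * S ?t)) = - \<i>"
      using CS'[of t] unfolding D_def by algebra
    have q: "?q * (D ?t)\<^sup>2 = -1"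
    proof -
      have "S ?t = e * z ?t * D ?t"
        using ee Dnz[of t] by (simp add: z_def)
      hence "?q * (D ?t)\<^sup>2 = (D ?t)\<^sup>2 - 2 * of_real r * S ?t * D ?t + (S ?t)\<^sup>2"
        by (simp add: power2_eq_square algebra_simps)
      also have "\<dots> = (1 - (of_real r)\<^sup>2) * (S ?t)\<^sup>2 - (C ?t)\<^sup>2"
        unfolding D_def by (simp add: power2_eq_square algebra_simps)
      also have "\<dots> = - ((C ?t)\<^sup>2 - of_real (s\<^sup>2) * (S ?t)\<^sup>2)"
        unfolding s by simp
      finally show ?thesis
        unfolding CS' .
    qed
    have "(z has_field_derivative cnj e * ((C ?t * D ?t - S ?t * (of_real r * C ?t - \<i> * (of_real (s\<^sup>2) * S ?t))) / (D ?t * D ?t))) (at ?t)"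
      unfolding z_def D_def using Dnz[of t, unfolded D_def] S C
      by (intro DERIV_cmult DERIV_divide DERIV_diff) auto
    moreover have "- \<i> / (D ?t * D ?t) = \<i> * Q" if "Q * (D ?t)\<^sup>2 = -1" for Q
    proof -
      have "\<i> * Q * (D ?t * D ?t) = - \<i>"
        using that by (simp add: power2_eq_square mult.assoc)
      thus ?thesis
        using Dnz[of t] by (metis mult_eq_0_iff nonzero_mult_div_cancel_right)
    qed
    ultimately have "(z has_field_derivative cnj e * (\<i> * ?q)) (at ?t)"
      unfolding num using q by metis
    moreover have "(f has_field_derivative deriv f (z ?t)) (at (z ?t))"
      by (rule holomorphic_derivI[OF f open_ball zin])
    ultimately have "((\<lambda>t. f (z t)) has_field_derivative deriv f (z ?t) * (cnj e * (\<i> * ?q))) (at ?t)"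
      by (rule DERIV_chain2[rotated])
    moreover have "deriv f (z ?t) * (cnj e * (\<i> * ?q)) = v"
      unfolding v_def ode[OF zin[of t], symmetric] by (simp only: mult_ac)
    ultimately have "((\<lambda>t. f (z t) - t * v) has_field_derivative 0) (at ?t)"
      by (auto intro!: derivative_eq_intros)
    thus ?thesis
      by (rule has_vector_derivative_real_field)
  qed
  then obtain k where k: "\<And>t. f (z (of_real t)) - of_real t * v = k"
    using has_vector_derivative_zero_constant[OF convex_UNIV, of "\<lambda>t. f (z (of_real t)) - of_real t * v"]
    by (metis UNIV_I has_vector_derivative_at_within)
  have "f 0 = k"
    using k[of 0] S0 by (simp add: z_def)
  hence "f (z (of_real t)) = f 0 + of_real t * v"
    using k[of t] by (simp add: algebra_simps)
  thus ?thesis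
    using zin[of t] unfolding v_def by (metis imageI)
qed

section \<open>Convex domains containing a full line\<close>

lemma convex_containing_line:
  fixes \<Omega> :: "'a::real_normed_vector set"
  assumes \<Omega>: "open \<Omega>" "convex \<Omega>" and v: "v \<noteq> 0" and line: "\<And>t :: real. w0 + t *\<^sub>R v \<in> \<Omega>" and w: "w \<in> \<Omega>"
  shows "w + t *\<^sub>R v \<in> \<Omega>"
proof -
  have "((\<lambda>\<epsilon>::real. w + \<epsilon> *\<^sub>R (w - w0)) \<longlongrightarrow> w) (at_right 0)"
    by (auto intro!: tendsto_eq_intros)
  hence "eventually (\<lambda>\<epsilon>::real. w + \<epsilon> *\<^sub>R (w - w0) \<in> \<Omega>) (at_right 0)"
    using \<Omega>(1) w by (auto elim!: topological_tendstoD)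
  moreover have "eventually (\<lambda>\<epsilon>::real. \<epsilon> > 0) (at_right 0)"
    by (rule eventually_at_right_less)
  ultimately have "eventually (\<lambda>\<epsilon>::real. w + \<epsilon> *\<^sub>R (w - w0) \<in> \<Omega> \<and> \<epsilon> > 0) (at_right 0)"
    by (rule eventually_conj)
  then obtain \<epsilon> :: real where \<epsilon>: "w + \<epsilon> *\<^sub>R (w - w0) \<in> \<Omega>" "\<epsilon> > 0"
    using eventually_happens trivial_limit_at_right_real by blast
  \<comment> \<open>A point slightly beyond \<open>w\<close>, seen from \<open>w0\<close>, is
    combined with a point \<open>?y\<close> on the line. The weights cancel the two contributions of
    \<open>w0\<close>, and the factor \<open>(1 + \<epsilon>) / \<epsilon>\<close> compensates
    \<open>?b\<close>.\<close>
  let ?a = "1 / (1 + \<epsilon>)" and ?b = "\<epsilon> / (1 + \<epsilon>)" and ?y = "w0 + (t * (1 + \<epsilon>) / \<epsilon>) *\<^sub>R v"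
  have ab: "?a + ?b = 1"
    using \<epsilon>(2) by (simp flip: add_divide_distrib)
  have "?a *\<^sub>R (w + \<epsilon> *\<^sub>R (w - w0)) + ?b *\<^sub>R ?y \<in> \<Omega>"
    using \<epsilon> ab by (intro convexD[OF \<Omega>(2) _ line]) auto
  also have "?a *\<^sub>R (w + \<epsilon> *\<^sub>R (w - w0)) + ?b *\<^sub>R ?y = (?a + ?b) *\<^sub>R w + (?b * (t * (1 + \<epsilon>) / \<epsilon>)) *\<^sub>R v"
    by (simp add: algebra_simps scaleR_conv_of_real)
  also have "\<dots> = w + t *\<^sub>R v"
    unfolding ab using \<epsilon>(2) by simp
  finally show ?thesis .
qed

text \<open>Invariance along \<open>v\<close> makes \<open>\<Omega>\<close> the preimage of
  \<open>I\<close> under the coordinate normal to \<open>v\<close>. As \<open>I\<close> is an open,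
  nonempty, proper interval, it is a ray or a bounded open interval.\<close>

lemma strip_or_half_plane_of_line:
  assumes \<Omega>: "open \<Omega>" "convex \<Omega>" "\<Omega> \<noteq> UNIV" and v: "v \<noteq> 0"
    and line: "\<And>t :: real. w0 + t *\<^sub>R v \<in> \<Omega>"
  shows "parallel_strip \<Omega> \<or> half_plane \<Omega>"
proof -
  define n where "n = \<i> * v"
  have n: "n \<noteq> 0"
    using v by (simp add: n_def)
  define I where "I = (\<lambda>w. n \<bullet> w) ` \<Omega>"
  have \<Omega>I: "w \<in> \<Omega> \<longleftrightarrow> n \<bullet> w \<in> I" for w
  proof
    assume "n \<bullet> w \<in> I"
    then obtain w' where w': "w' \<in> \<Omega>" "n \<bullet> w = n \<bullet> w'"
      by (auto simp: I_def)
    define u where "u = sgn v"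
    have u: "norm u = 1" "v = norm v *\<^sub>R u"
      using v by (simp_all add: u_def norm_sgn sgn_div_norm)
    have "n \<bullet> (w - w') = 0"
      using w'(2) by (simp add: inner_diff_right)
    moreover have "n = norm v *\<^sub>R (\<i> * u)"
      using v by (simp add: n_def u_def sgn_div_norm)
    ultimately have "(w - w') \<bullet> (\<i> * u) = 0"
      using v by (simp add: inner_commute)
    with complex_orthonormal_expansion[OF u(1), of "w - w'"]
    have "w = w' + ((w - w') \<bullet> u) *\<^sub>R u"
      by (simp add: algebra_simps)
    also have "\<dots> = w' + (((w - w') \<bullet> u) / norm v) *\<^sub>R v"
      unfolding divide_inverse
      by (simp only: scaleR_scaleR[symmetric] u_def[unfolded sgn_div_norm, symmetric])
    also have "\<dots> \<in> \<Omega>"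
      by (rule convex_containing_line[OF \<Omega>(1,2) v line w'(1)])
    finally show "w \<in> \<Omega>" .
  qed (simp add: I_def)
  have "surj (\<lambda>w. n \<bullet> w)"
  proof (rule surjI)
    show "n \<bullet> ((y / (n \<bullet> n)) *\<^sub>R n) = y" for y
      using n by simp
  qed
  hence "open I"
    unfolding I_def
    by (intro open_surjective_linear_image \<Omega> bounded_linear.linear bounded_linear_inner_right)
  hence gt: "\<exists>y\<in>I. x < y" and lt: "\<exists>y\<in>I. y < x" if "x \<in> I" for x
    using that open_contains_cball[of I] by (fastforce simp: subset_iff dist_real_def intro: bexI[of _ "x + _"] bexI[of _ "x - _"])+
  have "convex I"
    unfolding I_def by (intro convex_linear_image \<Omega> bounded_linear.linear bounded_linear_inner_right)
  hence ivl: "x \<in> I" if "a \<in> I" "b \<in> I" "a \<le> x" "x \<le> b" for a b x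
    using that mem_is_interval_1_I is_interval_convex_1 by blast
  have ne: "I \<noteq> {}"
    using line by (auto simp: I_def)
  have nU: "I \<noteq> UNIV"
    using \<Omega>(3) \<Omega>I by auto
  have "\<exists>a b. I = {} \<or> I = UNIV \<or> I = {..<b} \<or> I = {..b} \<or> I = {a<..} \<or> I = {a..} \<or>
      I = {a<..<b} \<or> I = {a<..b} \<or> I = {a..<b} \<or> I = {a..b}"
    by (rule interval_cases) (rule ivl)
  moreover have "I \<noteq> {..b}" "I \<noteq> {a<..b}" "I \<noteq> {a..b}" for a b
    using gt[of b] ne by auto
  moreover have "I \<noteq> {a..}" "I \<noteq> {a..<b}" for a b
    using lt[of a] ne by auto
  ultimately obtain a b where "I = {..<b} \<or> I = {a<..} \<or> I = {a<..<b}"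
    using ne nU by blast
  then consider "I = {..<b}" | "I = {a<..}" | "I = {a<..<b}" "a < b"
    using ne by fastforce
  thus ?thesis
  proof cases
    case 1
    hence "\<Omega> = {w. - b < - n \<bullet> w}"
      using \<Omega>I by auto
    thus ?thesis
      using n unfolding half_plane_def by (metis neg_equal_0_iff_equal)
  next
    case 2
    hence "\<Omega> = {w. a < n \<bullet> w}"
      using \<Omega>I by auto
    thus ?thesis
      using n unfolding half_plane_def by blast
  next
    case 3
    hence "\<Omega> = {w. a < n \<bullet> w \<and> n \<bullet> w < b}"
      using \<Omega>I by auto
    thus ?thesis
      using n 3 unfolding parallel_strip_def by blast
  qed
qed

subsection \<open>Gradient and Hessian of the logarithm of the density\<close>

definition log_density :: "complex set \<Rightarrow> complex \<Rightarrow> real" where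
  "log_density \<Omega> w = ln (poincare_density \<Omega> w)"

text \<open>As a complex number, the gradient of a real function is the conjugate of twice its
  Wirtinger derivative. The two summands come from \<open>- ln (1 - |z|^2)\<close> and
  \<open>- ln |f'|\<close>, and the outer division by \<open>deriv f\<close> from the chain rule for
  \<open>F\<close>.\<close>

lemma log_density_gradient:
  assumes f: "conformal_map_onto f \<Omega>" and w: "w \<in> \<Omega>"
    and F: "\<And>w. w \<in> \<Omega> \<Longrightarrow> F w \<in> ball 0 1 \<and> f (F w) = w"
      "(F has_field_derivative 1 / deriv f (F w)) (at w)"
  shows "GDERIV (log_density \<Omega>) w :>
    cnj ((2 * cnj (F w) / (1 - F w * cnj (F w)) - deriv (deriv f) (F w) / deriv f (F w)) / deriv f (F w))"
proof -
  define z where "z = F w"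
  have z: "z \<in> ball 0 1"
    using F(1)[OF w] by (simp add: z_def)
  have fh: "f holomorphic_on ball 0 1"
    using f by (auto simp: conformal_map_onto_def)
  have op: "open \<Omega>"
    using conformal_map_inverse[OF f] by metis
  have f'nz: "deriv f x \<noteq> 0" if "x \<in> ball 0 1" for x
    using conformal_map_inverse[OF f] that by metis
  define U where "U x = - ln (1 - x \<bullet> x) - ln (deriv f x \<bullet> deriv f x) / 2" for x
  have eq: "U (F x) = log_density \<Omega> x" if x: "x \<in> \<Omega>" for x
  proof -
    have Fx: "F x \<in> ball 0 1" "f (F x) = x"
      using F(1)[OF x] by auto
    have pos: "1 - (norm (F x))\<^sup>2 > 0"
      using Fx(1) by (simp add: power_less_one_iff)
    have "poincare_density \<Omega> x = 1 / ((1 - (norm (F x))\<^sup>2) * norm (deriv f (F x)))"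
      using poincare_density_conformal_map[OF f Fx(1)] Fx(2) by simp
    thus ?thesis
      using pos f'nz[OF Fx(1)]
      by (simp add: U_def log_density_def ln_div ln_mult ln_realpow flip: power2_norm_eq_inner)
  qed
  have zz: "1 - z \<bullet> z > 0"
    using z by (simp add: power_less_one_iff flip: power2_norm_eq_inner)
  have d1: "(deriv f has_derivative (\<lambda>h. deriv (deriv f) z * h)) (at z)"
    using holomorphic_derivI[OF holomorphic_deriv[OF fh open_ball] open_ball z]
    by (simp add: has_field_derivative_def)
  have "(U has_derivative (\<lambda>h. 2 * (z \<bullet> h) / (1 - z \<bullet> z)
      - ((deriv (deriv f) z * h) \<bullet> deriv f z) / (deriv f z \<bullet> deriv f z))) (at z)"
    unfolding U_def using zz f'nz[OF z]
    by (auto intro!: derivative_eq_intros d1 simp: inner_commute field_simps)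
  moreover have "(F has_derivative (\<lambda>h. h / deriv f z)) (at w)"
    using F(2) by (simp add: has_field_derivative_def z_def mult_commute_abs divide_inverse)
  ultimately have "((\<lambda>x. U (F x)) has_derivative (\<lambda>h. 2 * (z \<bullet> (h / deriv f z)) / (1 - z \<bullet> z)
      - ((deriv (deriv f) z * (h / deriv f z)) \<bullet> deriv f z) / (deriv f z \<bullet> deriv f z))) (at w)"
    unfolding z_def by (rule has_derivative_compose[rotated])
  moreover have "2 * (z \<bullet> (h / deriv f z)) / (1 - z \<bullet> z)
      - ((deriv (deriv f) z * (h / deriv f z)) \<bullet> deriv f z) / (deriv f z \<bullet> deriv f z)
    = h \<bullet> cnj ((2 * cnj z / (1 - z * cnj z) - deriv (deriv f) z / deriv f z) / deriv f z)" for h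
  proof -
    have ip: "a \<bullet> b = Re (cnj a * b)" for a b
      by (simp add: inner_complex_def)
    have nn: "cnj a * a = of_real (a \<bullet> a)" for a
      using complex_norm_square[of a] by (simp add: power2_norm_eq_inner mult.commute)
    have re: "Re (2 * a / of_real r * b) = 2 * Re (a * b) / r" for a b r
    proof -
      have "2 * a / of_real r * b = 2 * (a * b) / of_real r"
        by simp
      thus ?thesis
        by (simp only: Re_divide_of_real) simp
    qed
    have "2 * (z \<bullet> (h / deriv f z)) / (1 - z \<bullet> z) = Re (2 * cnj z / of_real (1 - z \<bullet> z) * (h / deriv f z))"
      unfolding re ip[of z "h / deriv f z"] ..
    moreover have "((deriv (deriv f) z * (h / deriv f z)) \<bullet> deriv f z) / (deriv f z \<bullet> deriv f z)
        = Re (deriv (deriv f) z / deriv f z * (h / deriv f z))"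
    proof -
      have quot: "(a \<bullet> b) / (b \<bullet> b) = Re (a / b)" if "b \<noteq> 0" for a b
      proof -
        have "Re (a / b) = Re (cnj b * a / (cnj b * b))"
          using that by simp
        also have "\<dots> = (a \<bullet> b) / (b \<bullet> b)"
          unfolding nn Re_divide_of_real inner_commute[of a b] ip[of b a] ..
        finally show ?thesis ..
      qed
      show ?thesis
        unfolding quot[OF f'nz[OF z]] by simp
    qed
    moreover have "1 - z * cnj z = of_real (1 - z \<bullet> z)"
      using nn[of z] by (simp add: mult.commute)
    ultimately show ?thesis
      unfolding inner_commute[of h] ip[of "cnj _"] by (simp add: left_diff_distrib diff_divide_distrib)
  qed
  ultimately have "GDERIV (\<lambda>x. U (F x)) w :>
      cnj ((2 * cnj z / (1 - z * cnj z) - deriv (deriv f) z / deriv f z) / deriv f z)"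
    by (simp add: gderiv_def)
  thus ?thesis
    unfolding gderiv_def z_def[symmetric]
    by (rule has_derivative_transform_within_open[OF _ op w]) (rule eq)
qed

text \<open>The derivative of the preceding gradient formula at the centre: \<open>2 * cnj h\<close>
  stems from the disc term, \<open>- p'\<close> from \<open>P\<close>, and \<open>p\<^sup>2\<close>
  from differentiating \<open>1 / deriv f\<close>.\<close>

lemma log_density_hessian:
  assumes f: "conformal_map_onto f \<Omega>" and f0: "f 0 = w0"
  defines "p \<equiv> deriv (deriv f) 0 / deriv f 0"
    and "p' \<equiv> deriv (\<lambda>z. deriv (deriv f) z / deriv f z) 0"
  shows "grad (log_density \<Omega>) w0 = - cnj (p / deriv f 0)"
    and "(grad (log_density \<Omega>) has_derivative
           (\<lambda>h. cnj ((2 * cnj (h / deriv f 0) - (p' - p\<^sup>2) * (h / deriv f 0)) / deriv f 0))) (at w0)"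
proof -
  obtain F where F: "open \<Omega>" "F ` \<Omega> \<subseteq> ball 0 1" "\<And>w. w \<in> \<Omega> \<Longrightarrow> f (F w) = w"
      "\<And>z. z \<in> ball 0 1 \<Longrightarrow> F (f z) = z" "\<And>z. z \<in> ball 0 1 \<Longrightarrow> deriv f z \<noteq> 0"
      "\<And>w. w \<in> \<Omega> \<Longrightarrow> (F has_field_derivative 1 / deriv f (F w)) (at w)"
    using conformal_map_inverse[OF f] by metis
  have fh: "f holomorphic_on ball 0 1" and fim: "f ` ball 0 1 = \<Omega>"
    using f by (auto simp: conformal_map_onto_def)
  have w0: "w0 \<in> \<Omega>"
    using f0 fim by force
  have F0: "F w0 = 0"
    using f0 F(4)[of 0] by simp
  let ?P = "\<lambda>z. deriv (deriv f) z / deriv f z"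
  define E where "E z = cnj ((2 * cnj z / (1 - z * cnj z) - ?P z) / deriv f z)" for z
  have FF: "F w \<in> ball 0 1 \<and> f (F w) = w" if "w \<in> \<Omega>" for w
    using F(2,3) that by blast
  have G: "grad (log_density \<Omega>) w = E (F w)" if "w \<in> \<Omega>" for w
    unfolding E_def by (rule gradient_unique[OF log_density_gradient[OF f that FF F(6)[OF that]]])
  show "grad (log_density \<Omega>) w0 = - cnj (p / deriv f 0)"
    using G[OF w0] by (simp add: E_def F0 p_def)
  have c: "deriv f 0 \<noteq> 0"
    using F(5) by simp
  have f'h: "deriv f holomorphic_on ball 0 1"
    using fh by (intro holomorphic_deriv) auto
  have Ph: "?P holomorphic_on ball 0 1"
    using F(5) f'h fh by (intro holomorphic_intros holomorphic_deriv) auto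
  have dP: "(?P has_derivative (\<lambda>h. p' * h)) (at 0)"
    using holomorphic_derivI[OF Ph open_ball, of 0] by (simp add: has_field_derivative_def p'_def)
  have df: "(deriv f has_derivative (\<lambda>h. p * deriv f 0 * h)) (at 0)"
    using holomorphic_derivI[OF f'h open_ball, of 0] c by (simp add: has_field_derivative_def p_def)
  have dz: "((\<lambda>z. 2 * cnj z / (1 - z * cnj z)) has_derivative (\<lambda>h. 2 * cnj h)) (at 0)"
    by (auto intro!: derivative_eq_intros)
  have "(E has_derivative (\<lambda>h. cnj ((2 * cnj h - (p' - p\<^sup>2) * h) / deriv f 0))) (at (F w0))"
  proof -
    have "(\<lambda>h. cnj (((2 * cnj h - p' * h) * deriv f 0
          - (2 * cnj 0 / (1 - 0 * cnj 0) - deriv (deriv f) 0 / deriv f 0) * (p * deriv f 0 * h)) / (deriv f 0 * deriv f 0)))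
        = (\<lambda>h. cnj ((2 * cnj h - (p' - p\<^sup>2) * h) / deriv f 0))"
      using c unfolding p_def[symmetric] by (simp add: fun_eq_iff power2_eq_square field_simps)
    with has_derivative_cnj[OF has_derivative_divide'[OF has_derivative_diff[OF dz dP] df c]]
    show ?thesis
      unfolding E_def F0 by simp
  qed
  moreover have "(F has_derivative (\<lambda>h. h / deriv f 0)) (at w0)"
    using F(6)[OF w0] F0 by (simp add: has_field_derivative_def divide_inverse mult_commute_abs)
  ultimately have "((\<lambda>w. E (F w)) has_derivative
      (\<lambda>h. cnj ((2 * cnj (h / deriv f 0) - (p' - p\<^sup>2) * (h / deriv f 0)) / deriv f 0))) (at w0)"
    by (rule has_derivative_compose[rotated])
  thus "(grad (log_density \<Omega>) has_derivative
      (\<lambda>h. cnj ((2 * cnj (h / deriv f 0) - (p' - p\<^sup>2) * (h / deriv f 0)) / deriv f 0))) (at w0)"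
    by (rule has_derivative_transform_within_open[OF _ F(1) w0]) (simp add: G)
qed

text \<open>Evaluates the Hessian form, with \<open>m = p' - p\<^sup>2\<close>. Replacing
  \<open>h\<close> by \<open>\<i> * h\<close> keeps the first term and flips the second, so the
  trace is \<open>4 / |c|^2\<close>: Liouville's equation for a metric of curvature -4.\<close>

lemma complex_second_order_form:
  fixes c m h :: complex
  assumes "c \<noteq> 0"
  shows "cnj ((2 * cnj (h / c) - m * (h / c)) / c) \<bullet> h = 2 * (norm (h / c))\<^sup>2 - Re (m * (h / c)\<^sup>2)"
proof -
  define y where "y = h / c"
  have h: "h = y * c"
    using assms by (simp add: y_def)
  have "cnj ((2 * cnj y - m * y) / c) \<bullet> h = Re ((2 * cnj y - m * y) / c * h)"
    unfolding inner_complex_def times_complex.sel by (simp only: cnj.sel mult_minus_left diff_conv_add_uminus)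
  also have "(2 * cnj y - m * y) / c * h = 2 * (y * cnj y) - m * y\<^sup>2"
  proof -
    have "(2 * cnj y - m * y) / c * h = (2 * cnj y - m * y) * y"
      unfolding h using assms by simp
    thus ?thesis
      by (simp add: power2_eq_square algebra_simps)
  qed
  also have "Re \<dots> = 2 * (norm y)\<^sup>2 - Re (m * y\<^sup>2)"
    unfolding complex_norm_square[symmetric] by simp
  finally show ?thesis
    by (simp add: y_def)
qed

section \<open>Curvature of level sets in a proper convex domain\<close>

locale convex_domain =
  fixes \<Omega> :: "complex set"
  assumes open_domain: "open \<Omega>" and is_convex: "convex \<Omega>"
    and proper: "\<Omega> \<noteq> {}" "\<Omega> \<noteq> UNIV"
begin

abbreviation "G \<equiv> grad (log_density \<Omega>)"

lemma centered_map:
  assumes "w \<in> \<Omega>"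
  obtains f where "conformal_map_onto f \<Omega>" "f 0 = w"
  using conformal_map_centered_exists[OF open_domain is_convex proper(2) assms] .

lemma density_pos: "w \<in> \<Omega> \<Longrightarrow> poincare_density \<Omega> w > 0"
  by (rule centered_map[of w]) (auto intro: poincare_density_pos)

lemma density_affine:
  assumes "\<alpha> \<noteq> 0" "(\<lambda>w. \<alpha> * w + \<beta>) ` \<Omega> = \<Omega>" "w \<in> \<Omega>"
  shows "poincare_density \<Omega> (\<alpha> * w + \<beta>) = poincare_density \<Omega> w / norm \<alpha>"
  by (rule centered_map[OF assms(3)]) (rule poincare_density_affine[OF _ assms])

lemma GDERIV_log_density:
  assumes "w \<in> \<Omega>"
  shows "GDERIV (log_density \<Omega>) w :> G w"
proof -
  obtain f where f: "conformal_map_onto f \<Omega>"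
    using centered_map[OF assms] by metis
  obtain F where F: "F ` \<Omega> \<subseteq> ball 0 1" "\<And>w. w \<in> \<Omega> \<Longrightarrow> f (F w) = w"
      "\<And>w. w \<in> \<Omega> \<Longrightarrow> (F has_field_derivative 1 / deriv f (F w)) (at w)"
    using conformal_map_inverse[OF f] by metis
  have "\<exists>D. GDERIV (log_density \<Omega>) w :> D"
    using log_density_gradient[OF f assms _ F(3)[OF assms]] F(1,2) by blast
  thus ?thesis
    using gradient_unique by metis
qed

lemma G_differentiable: "w \<in> \<Omega> \<Longrightarrow> G differentiable (at w)"
  by (rule centered_map[of w]) (auto simp: differentiable_def dest: log_density_hessian(2))

lemma GDERIV_density:
  assumes w: "w \<in> \<Omega>"
  shows "GDERIV (poincare_density \<Omega>) w :> poincare_density \<Omega> w *\<^sub>R G w"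
proof -
  have "GDERIV (\<lambda>x. exp (log_density \<Omega> x)) w :> exp (log_density \<Omega> w) *\<^sub>R G w"
    using GDERIV_DERIV_compose[OF GDERIV_log_density[OF w] DERIV_exp] .
  moreover have "exp (log_density \<Omega> x) = poincare_density \<Omega> x" if "x \<in> \<Omega>" for x
    using density_pos[OF that] by (simp add: log_density_def)
  ultimately show ?thesis
    unfolding gderiv_def using w
    by (auto elim!: has_derivative_transform_within_open[OF _ open_domain])
qed

lemma grad_density: "w \<in> \<Omega> \<Longrightarrow> grad (poincare_density \<Omega>) w = poincare_density \<Omega> w *\<^sub>R G w"
  using GDERIV_density by (rule gradient_unique)

lemma grad_density_eq_0_iff: "w \<in> \<Omega> \<Longrightarrow> grad (poincare_density \<Omega>) w = 0 \<longleftrightarrow> G w = 0"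
  using density_pos[of w] by (simp add: grad_density)

lemma level_set_eq:
  assumes "w \<in> \<Omega>"
  shows "level_set \<Omega> (poincare_density \<Omega> w) = {x \<in> \<Omega>. log_density \<Omega> x = log_density \<Omega> w}"
  using density_pos assms by (auto simp: level_set_def log_density_def)

text \<open>The density and \<open>log_density\<close> share level sets and gradient directions, so
  the general formula applies to the latter.\<close>

lemma signed_curvature_eq:
  assumes w: "w \<in> \<Omega>" and nz: "G w \<noteq> 0" and G': "(G has_derivative G') (at w)"
  defines "t \<equiv> \<i> * sgn (G w)"
  shows "signed_curvature \<Omega> (poincare_density \<Omega> w) w = (G' t \<bullet> t) / norm (G w)"
proof -
  have "sgn (grad (poincare_density \<Omega>) w) = sgn (G w)"
    using density_pos[OF w] by (simp add: grad_density[OF w] sgn_scaleR)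
  thus ?thesis
    using arclength_curvature_eq[OF open_domain w GDERIV_log_density G_differentiable nz G']
    unfolding signed_curvature_def level_set_eq[OF w] t_def by simp
qed

lemma signed_curvature_nonneg:
  assumes w: "w \<in> \<Omega>" and nz: "G w \<noteq> 0"
  shows "signed_curvature \<Omega> (poincare_density \<Omega> w) w \<ge> 0"
    and "signed_curvature \<Omega> (poincare_density \<Omega> w) w = 0 \<Longrightarrow> parallel_strip \<Omega> \<or> half_plane \<Omega>"
proof -
  obtain f where f: "conformal_map_onto f \<Omega>" "f 0 = w"
    using centered_map[OF w] .
  have fh: "f holomorphic_on ball 0 1" and fim: "f ` ball 0 1 = \<Omega>"
    using f by (auto simp: conformal_map_onto_def)
  define c where "c = deriv f 0"
  define p where "p = deriv (deriv f) 0 / deriv f 0"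
  define p' where "p' = deriv (\<lambda>z. deriv (deriv f) z / deriv f z) 0"
  have c: "c \<noteq> 0"
    using conformal_map_inverse[OF f(1)] unfolding c_def by (metis centre_in_ball zero_less_one)
  have Gw: "G w = - cnj (p / c)"
    and G': "(G has_derivative (\<lambda>h. cnj ((2 * cnj (h / c) - (p' - p\<^sup>2) * (h / c)) / c))) (at w)"
    using log_density_hessian[OF f] unfolding p_def p'_def c_def by blast+
  have p: "p \<noteq> 0"
    using nz Gw by auto
  define M where "M = 2 * (norm p)\<^sup>2 + Re ((p' - p\<^sup>2) * (cnj p)\<^sup>2)"
  define t where "t = \<i> * sgn (G w)"
  have nt: "norm t = 1"
    using nz by (simp add: t_def norm_mult norm_sgn)
  \<comment> \<open>Since \<open>G w = - cnj (p / c)\<close> and \<open>t\<close> is its direction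
    turned by \<open>\<i>\<close>, the square is a negative multiple of
    \<open>(cnj p)\<^sup>2\<close>. The sign turns the minus in the Hessian form into the plus in
    \<open>M\<close>.\<close>
  have "(t / c)\<^sup>2 = - ((cnj p)\<^sup>2 / of_real ((norm p)\<^sup>2 * (norm c)\<^sup>2))"
  proof -
    have "t\<^sup>2 = - ((cnj p)\<^sup>2 / (cnj c)\<^sup>2 * (of_real ((norm c)\<^sup>2) / of_real ((norm p)\<^sup>2)))"
    proof -
      have "norm (G w) = norm p / norm c"
        by (simp add: Gw norm_divide)
      hence "t = - (\<i> * of_real (norm c / norm p) * cnj (p / c))"
        unfolding t_def sgn_div_norm by (simp add: Gw scaleR_conv_of_real)
      thus ?thesis
        by (simp add: power_mult_distrib power_divide mult.commute)
    qed
    thus ?thesis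
      unfolding of_real_mult complex_norm_square using c p
      by (simp add: power_divide field_simps power2_eq_square)
  qed
  hence "Re ((p' - p\<^sup>2) * (t / c)\<^sup>2)
      = Re (- ((p' - p\<^sup>2) * (cnj p)\<^sup>2 / of_real ((norm p)\<^sup>2 * (norm c)\<^sup>2)))"
    by simp
  also have "\<dots> = - (Re ((p' - p\<^sup>2) * (cnj p)\<^sup>2) / ((norm p)\<^sup>2 * (norm c)\<^sup>2))"
    by (simp only: uminus_complex.sel Re_divide_of_real)
  finally have "(cnj ((2 * cnj (t / c) - (p' - p\<^sup>2) * (t / c)) / c)) \<bullet> t
      = 2 * (norm (t / c))\<^sup>2 + Re ((p' - p\<^sup>2) * (cnj p)\<^sup>2) / ((norm p)\<^sup>2 * (norm c)\<^sup>2)"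
    unfolding complex_second_order_form[OF c] by simp
  also have "\<dots> = M / ((norm p)\<^sup>2 * (norm c)\<^sup>2)"
    using nt c p by (simp add: M_def norm_divide power_divide add_divide_distrib)
  finally have form: "(cnj ((2 * cnj (t / c) - (p' - p\<^sup>2) * (t / c)) / c)) \<bullet> t = M / ((norm p)\<^sup>2 * (norm c)\<^sup>2)" .
  have \<kappa>: "signed_curvature \<Omega> (poincare_density \<Omega> w) w = M / ((norm p)\<^sup>2 * (norm c)\<^sup>2 * norm (G w))"
    unfolding signed_curvature_eq[OF w nz G', folded t_def] form by simp
  note M = convex_map_second_order[OF f(1) is_convex, folded p_def p'_def, OF p, folded M_def]
  show "signed_curvature \<Omega> (poincare_density \<Omega> w) w \<ge> 0"
    unfolding \<kappa> using M(1) by simp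
  assume "signed_curvature \<Omega> (poincare_density \<Omega> w) w = 0"
  hence "M = 0"
    unfolding \<kappa> using c p nz by simp
  from M(2)[OF this] obtain r e where re: "0 < r" "r \<le> 1" "norm e = 1"
      and ode: "\<And>z. z \<in> ball 0 1 \<Longrightarrow> deriv f z * (1 - 2 * of_real r * e * z + e\<^sup>2 * z\<^sup>2) = c"
    by (auto simp: c_def)
  have "f 0 + t *\<^sub>R (\<i> * c * cnj e) \<in> \<Omega>" for t
    using image_contains_line[OF fh re ode, of t] fim by (simp add: scaleR_conv_of_real)
  moreover have "\<i> * c * cnj e \<noteq> 0"
    using c re by auto
  ultimately show "parallel_strip \<Omega> \<or> half_plane \<Omega>"
    using strip_or_half_plane_of_line[OF open_domain is_convex proper(2)] by metis
qed

end

section \<open>Domains invariant under translations along a line\<close>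

locale translation_invariant_domain = convex_domain +
  fixes v :: complex
  assumes direction_nonzero: "v \<noteq> 0"
    and translate: "\<And>w t. w \<in> \<Omega> \<Longrightarrow> w + t *\<^sub>R v \<in> \<Omega>"
begin

lemma log_density_translate:
  assumes "w \<in> \<Omega>"
  shows "log_density \<Omega> (w + t *\<^sub>R v) = log_density \<Omega> w"
proof -
  have "(\<lambda>w. 1 * w + t *\<^sub>R v) ` \<Omega> = \<Omega>"
  proof (intro equalityI subsetI)
    fix w assume "w \<in> \<Omega>"
    thus "w \<in> (\<lambda>w. 1 * w + t *\<^sub>R v) ` \<Omega>"
      using translate[of w "- t"] by (intro image_eqI[of _ _ "w + (- t) *\<^sub>R v"]) auto
  qed (use translate in auto)
  from density_affine[OF _ this assms] show ?thesis
    by (simp add: log_density_def)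
qed

lemma G_translate:
  assumes w: "w \<in> \<Omega>"
  shows "G (w + t *\<^sub>R v) = G w"
proof -
  have "((\<lambda>x. x + t *\<^sub>R v) has_derivative (\<lambda>h. h)) (at w)"
    by (auto intro!: derivative_eq_intros)
  from has_derivative_compose[OF this GDERIV_log_density[OF translate[OF w], unfolded gderiv_def]]
  have "GDERIV (\<lambda>x. log_density \<Omega> (x + t *\<^sub>R v)) w :> G (w + t *\<^sub>R v)"
    by (simp add: gderiv_def)
  hence "GDERIV (log_density \<Omega>) w :> G (w + t *\<^sub>R v)"
    unfolding gderiv_def
    by (rule has_derivative_transform_within_open[OF _ open_domain w]) (rule log_density_translate)
  thus ?thesis
    using gradient_unique by metis
qed

text \<open>The line through \<open>w\<close> along \<open>v\<close>, run at unit speed, stays in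
  the level set and has no acceleration; any arclength parametrization may be used to evaluate the
  Hessian form.\<close>

lemma signed_curvature_eq_0:
  assumes w: "w \<in> \<Omega>" and nz: "G w \<noteq> 0"
  shows "signed_curvature \<Omega> (poincare_density \<Omega> w) w = 0"
proof -
  obtain G' where G': "(G has_derivative G') (at w)"
    using G_differentiable[OF w] by (auto simp: differentiable_def)
  have "arclength_param_at (\<lambda>s. w + s *\<^sub>R sgn v) {x \<in> \<Omega>. log_density \<Omega> x = log_density \<Omega> w} w 0"
    unfolding arclength_param_at_def
  proof (intro conjI exI[of _ 1] exI[of _ "\<lambda>_. sgn v"] ballI)
    show "w + s *\<^sub>R sgn v \<in> {x \<in> \<Omega>. log_density \<Omega> x = log_density \<Omega> w}" for s
      using translate[OF w, of "s / norm v"] log_density_translate[OF w, of "s / norm v"]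
      by (simp add: sgn_div_norm divide_inverse)
    show "((\<lambda>s. w + s *\<^sub>R sgn v) has_vector_derivative sgn v) (at s)" for s
      by (auto intro!: derivative_eq_intros)
  qed (use direction_nonzero in \<open>auto simp: norm_sgn\<close>)
  from arclength_param_curvature(1)[OF w GDERIV_log_density G' nz this] show ?thesis
    unfolding signed_curvature_eq[OF w nz G'] by simp
qed

text \<open>
  The Hessian of the logarithm of the density has positive trace and annihilates \<open>v\<close>, so it is
  positive in the orthogonal direction; a critical point is therefore the strict minimum of the
  density on a transversal.
\<close>
lemma level_set_at_critical_point:
  assumes w0: "w0 \<in> \<Omega>" and crit: "G w0 = 0"
  shows "level_set \<Omega> (poincare_density \<Omega> w0) = {w \<in> \<Omega>. (\<i> * v) \<bullet> w = (\<i> * v) \<bullet> w0}"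
proof -
  have u: "norm (sgn v) = 1" "v = norm v *\<^sub>R sgn v"
    using direction_nonzero by (simp_all add: norm_sgn sgn_div_norm)
  have along: "w - w0 = ((w - w0) \<bullet> (\<i> * sgn v)) *\<^sub>R (\<i> * sgn v) + ((w - w0) \<bullet> sgn v / norm v) *\<^sub>R v" for w
    using complex_orthonormal_expansion[OF u(1), of "w - w0"]
    by (simp add: sgn_div_norm divide_inverse)
  have iv: "(\<i> * v) \<bullet> w = (\<i> * v) \<bullet> w0 \<longleftrightarrow> (w - w0) \<bullet> (\<i> * sgn v) = 0" for w
    using direction_nonzero
    by (simp add: sgn_div_norm inner_commute[of _ "\<i> * v"] inner_diff_right)
  have pos: "G' (x *\<^sub>R (\<i> * sgn v)) \<bullet> (x *\<^sub>R (\<i> * sgn v)) > 0"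
    if w: "w \<in> \<Omega>" and G': "(G has_derivative G') (at w)" and x: "x \<noteq> 0" for w G' x
  proof -
    obtain f where f: "conformal_map_onto f \<Omega>" "f 0 = w"
      using centered_map[OF w] .
    define c where "c = deriv f 0"
    have c: "c \<noteq> 0"
      using conformal_map_inverse[OF f(1)] unfolding c_def by (metis centre_in_ball zero_less_one)
    obtain m where m: "(G has_derivative (\<lambda>h. cnj ((2 * cnj (h / c) - m * (h / c)) / c))) (at w)"
      using log_density_hessian(2)[OF f] unfolding c_def by blast
    have G'eq: "G' = (\<lambda>h. cnj ((2 * cnj (h / c) - m * (h / c)) / c))"
      using G' m by (rule has_derivative_unique)
    have "((\<lambda>s. w + s *\<^sub>R v) has_derivative (\<lambda>s. s *\<^sub>R v)) (at 0)"
      by (auto intro!: derivative_eq_intros)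
    moreover have "(G has_derivative G') (at (w + 0 *\<^sub>R v))"
      using G' by simp
    ultimately have "((\<lambda>s. G (w + s *\<^sub>R v)) has_derivative (\<lambda>s. G' (s *\<^sub>R v))) (at 0)"
      by (rule has_derivative_compose)
    moreover have "((\<lambda>s. G (w + s *\<^sub>R v)) has_derivative (\<lambda>s. 0)) (at 0)"
      using w by (simp add: G_translate)
    ultimately have "(\<lambda>s. G' (s *\<^sub>R v)) = (\<lambda>s. 0)"
      by (rule has_derivative_unique)
    from fun_cong[OF this, of "x / norm v"] have "G' (x *\<^sub>R sgn v) = 0"
      by (simp add: sgn_div_norm divide_inverse)
    hence "G' (x *\<^sub>R sgn v) \<bullet> (x *\<^sub>R sgn v) = 0"
      by simp
    hence "2 * (norm (x *\<^sub>R sgn v / c))\<^sup>2 = Re (m * (x *\<^sub>R sgn v / c)\<^sup>2)"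
      unfolding G'eq complex_second_order_form[OF c] by simp
    moreover have "(x *\<^sub>R (\<i> * sgn v) / c)\<^sup>2 = - ((x *\<^sub>R sgn v / c)\<^sup>2)"
      by (simp add: power_divide scaleR_conv_of_real power_mult_distrib)
    moreover have "norm (x *\<^sub>R (\<i> * sgn v) / c) = norm (x *\<^sub>R sgn v / c)"
      by (simp add: norm_divide norm_mult)
    ultimately have "G' (x *\<^sub>R (\<i> * sgn v)) \<bullet> (x *\<^sub>R (\<i> * sgn v)) = 4 * (norm (x *\<^sub>R sgn v / c))\<^sup>2"
      unfolding G'eq complex_second_order_form[OF c] by simp
    thus ?thesis
      using x c direction_nonzero by (simp add: sgn_zero_iff)
  qed
  have "(w - w0) \<bullet> (\<i> * sgn v) = 0" if w: "w \<in> \<Omega>" and eq: "log_density \<Omega> w = log_density \<Omega> w0" for w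
  proof (rule ccontr)
    define x where "x = (w - w0) \<bullet> (\<i> * sgn v)"
    assume "(w - w0) \<bullet> (\<i> * sgn v) \<noteq> 0"
    hence x: "x \<noteq> 0"
      by (simp add: x_def)
    define d where "d = x *\<^sub>R (\<i> * sgn v)"
    \<comment> \<open>Sliding \<open>w\<close> along \<open>v\<close> onto the perpendicular through
      \<open>w0\<close> gives \<open>w1\<close>, without changing the density. The segment from
      \<open>w0\<close> to \<open>w1\<close> is the transversal on which it strictly
      increases.\<close>
    define w1 where "w1 = w0 + d"
    have w1: "w1 = w + (- ((w - w0) \<bullet> sgn v / norm v)) *\<^sub>R v"
      using along[of w] by (simp add: w1_def d_def x_def algebra_simps)
    have "w1 \<in> \<Omega>"
      unfolding w1 by (rule translate[OF w])
    have "log_density \<Omega> w1 = log_density \<Omega> w0"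
      unfolding w1 log_density_translate[OF w] by (rule eq)
    have seg: "w0 + s *\<^sub>R d \<in> \<Omega>" if "0 \<le> s" "s \<le> 1" for s
    proof -
      have "w0 + s *\<^sub>R d = (1 - s) *\<^sub>R w0 + s *\<^sub>R w1"
        by (simp add: w1_def algebra_simps)
      thus ?thesis
        using convexD[OF is_convex w0 \<open>w1 \<in> \<Omega>\<close>, of "1 - s" s] that by simp
    qed
    have line: "((\<lambda>s. w0 + s *\<^sub>R d) has_vector_derivative d) (at s)" for s
      by (auto intro!: derivative_eq_intros)
    define h' where "h' s = d \<bullet> G (w0 + s *\<^sub>R d)" for s
    have h: "((\<lambda>s. log_density \<Omega> (w0 + s *\<^sub>R d)) has_real_derivative h' s) (at s)"
      if "0 \<le> s" "s \<le> 1" for s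
      unfolding h'_def
      by (intro has_real_derivative_along_curve GDERIV_log_density seg that line)
    have h': "\<exists>y. (h' has_real_derivative y) (at s) \<and> y > 0" if s: "0 \<le> s" "s \<le> 1" for s
    proof -
      obtain G' where G': "(G has_derivative G') (at (w0 + s *\<^sub>R d))"
        using G_differentiable[OF seg[OF s]] by (auto simp: differentiable_def)
      have "((\<lambda>s. G (w0 + s *\<^sub>R d)) has_derivative (\<lambda>k. G' (k *\<^sub>R d))) (at s)"
        using has_derivative_compose[OF line[unfolded has_vector_derivative_def] G'] .
      hence "(h' has_derivative (\<lambda>k. d \<bullet> G' (k *\<^sub>R d))) (at s)"
        unfolding h'_def by (auto intro!: derivative_eq_intros)
      hence "(h' has_real_derivative d \<bullet> G' d) (at s)"
        using linear_scale[OF has_derivative_linear[OF G']]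
        by (simp add: has_field_derivative_def mult_commute_abs)
      thus ?thesis
        using pos[OF seg[OF s] G' x] by (auto simp: d_def inner_commute)
    qed
    have "h' s > 0" if "0 < s" "s \<le> 1" for s
    proof -
      have "h' 0 < h' s"
        using that h' by (intro DERIV_pos_imp_increasing[of 0 s h']) auto
      thus ?thesis
        by (simp add: h'_def crit)
    qed
    hence "log_density \<Omega> (w0 + 0 *\<^sub>R d) < log_density \<Omega> (w0 + 1 *\<^sub>R d)"
    proof (intro DERIV_pos_imp_increasing_open[of 0 1 "\<lambda>s. log_density \<Omega> (w0 + s *\<^sub>R d)"])
      show "continuous_on {0..1} (\<lambda>s. log_density \<Omega> (w0 + s *\<^sub>R d))"
        by (intro continuous_at_imp_continuous_on ballI DERIV_isCont[OF h]) auto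
    qed (use h in \<open>fastforce+\<close>)
    thus False
      using \<open>log_density \<Omega> w1 = log_density \<Omega> w0\<close> by (simp add: w1_def)
  qed
  moreover have "log_density \<Omega> w = log_density \<Omega> w0" if "w \<in> \<Omega>" "(w - w0) \<bullet> (\<i> * sgn v) = 0" for w
  proof -
    have "w = w0 + ((w - w0) \<bullet> sgn v / norm v) *\<^sub>R v"
      using along[of w] that(2) by (simp add: algebra_simps)
    thus ?thesis
      using log_density_translate[OF w0] by metis
  qed
  ultimately show ?thesis
    unfolding level_set_eq[OF w0] iv by blast
qed

end

text \<open>Dilations centred at a boundary point preserve the half-plane, so along a ray from that
  point the density is homogeneous of degree -1 and never stationary. This matters because
  \<open>has_level_curvature\<close> admits critical points only in a strip.\<close>

lemma (in convex_domain) half_plane_noncritical: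
  assumes S: "\<Omega> = {w. a < n \<bullet> w}" and n: "n \<noteq> 0" and w: "w \<in> \<Omega>"
  shows "G w \<noteq> 0"
proof
  assume crit: "G w = 0"
  \<comment> \<open>The foot of the perpendicular from the origin to the boundary line.\<close>
  define b where "b = (a / (n \<bullet> n)) *\<^sub>R n"
  have nb: "n \<bullet> b = a"
    using n by (simp add: b_def)
  have dil: "(\<lambda>w. of_real k * w + (1 - of_real k) * b) ` \<Omega> = \<Omega>" if k: "k > 0" for k
  proof -
    have mem: "of_real k * w + (1 - of_real k) * b \<in> \<Omega>" if "k > 0" "w \<in> \<Omega>" for k w
    proof -
      have "of_real k * w + (1 - of_real k) * b = k *\<^sub>R w + (1 - k) *\<^sub>R b"
        by (simp add: scaleR_conv_of_real)
      hence "n \<bullet> (of_real k * w + (1 - of_real k) * b) = k * (n \<bullet> w - a) + a"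
        unfolding \<open>_ = k *\<^sub>R w + _\<close> inner_add_right inner_scaleR_right nb by (simp add: algebra_simps)
      thus ?thesis
        using that by (simp add: S)
    qed
    have inv: "of_real k * (of_real (1 / k) * w + (1 - of_real (1 / k)) * b) + (1 - of_real k) * b = w" for w
      using k by (simp add: field_simps)
    show ?thesis
    proof (intro equalityI subsetI)
      fix w assume "w \<in> \<Omega>"
      thus "w \<in> (\<lambda>w. of_real k * w + (1 - of_real k) * b) ` \<Omega>"
        using inv[of w] mem[of "1 / k" w] k by (metis image_eqI zero_less_divide_1_iff)
    qed (use mem k in auto)
  qed
  have eq: "poincare_density \<Omega> (w + s *\<^sub>R (w - b)) = poincare_density \<Omega> w / (1 + s)" if "s > - 1" for s
  proof -
    have "w + s *\<^sub>R (w - b) = of_real (1 + s) * w + (1 - of_real (1 + s)) * b"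
      by (simp add: scaleR_conv_of_real algebra_simps)
    thus ?thesis
      using density_affine[OF _ dil[of "1 + s"] w] that by (simp del: of_real_add add: norm_of_real)
  qed
  have "((\<lambda>s. w + s *\<^sub>R (w - b)) has_vector_derivative w - b) (at 0)"
    by (auto intro!: derivative_eq_intros)
  hence "((\<lambda>s. poincare_density \<Omega> (w + s *\<^sub>R (w - b))) has_real_derivative
      (w - b) \<bullet> (poincare_density \<Omega> w *\<^sub>R G w)) (at 0)"
    using GDERIV_density[OF w] by (intro has_real_derivative_along_curve) simp_all
  moreover have "((\<lambda>s. poincare_density \<Omega> w / (1 + s)) has_real_derivative - poincare_density \<Omega> w) (at 0)"
    by (auto intro!: derivative_eq_intros)
  hence "((\<lambda>s. poincare_density \<Omega> (w + s *\<^sub>R (w - b))) has_real_derivative - poincare_density \<Omega> w) (at 0)"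
    by (rule has_field_derivative_transform_within_open[OF _ open_greaterThan[of "-1"]]) (use eq in auto)
  ultimately have "(w - b) \<bullet> (poincare_density \<Omega> w *\<^sub>R G w) = - poincare_density \<Omega> w"
    by (rule DERIV_unique)
  thus False
    using crit density_pos[OF w] by simp
qed

theorem theorem2:
  fixes \<Omega> :: "complex set"
  assumes "open \<Omega>" and "convex \<Omega>" and "\<Omega> \<noteq> {}" and "\<Omega> \<noteq> UNIV"
  shows "(\<forall>c w \<kappa>. has_level_curvature \<Omega> c w \<kappa> \<longrightarrow> 0 \<le> \<kappa>) \<and>
    ((\<exists>c w. has_level_curvature \<Omega> c w 0) \<longrightarrow>
       (parallel_strip \<Omega> \<or> half_plane \<Omega>) \<and>
       (\<forall>c. \<forall>w \<in> level_set \<Omega> c. has_level_curvature \<Omega> c w 0))"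
proof -
  interpret convex_domain \<Omega>
    using assms by unfold_locales
  have level: "w \<in> \<Omega> \<and> c = poincare_density \<Omega> w" if "w \<in> level_set \<Omega> c" for c w
    using that by (auto simp: level_set_def)
  have nonneg: "0 \<le> \<kappa>" if "has_level_curvature \<Omega> c w \<kappa>" for c w \<kappa>
    using that signed_curvature_nonneg(1)[of w] grad_density_eq_0_iff[of w] level[of w c]
    unfolding has_level_curvature_def by (auto split: if_splits)
  \<comment> \<open>At a critical point the definition of \<open>has_level_curvature\<close> itself
    supplies the strip.\<close>
  have zero: "parallel_strip \<Omega> \<or> half_plane \<Omega>" if "has_level_curvature \<Omega> c w 0" for c w
    using that signed_curvature_nonneg(2)[of w] grad_density_eq_0_iff[of w] level[of w c]
    unfolding has_level_curvature_def by (auto split: if_splits)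
  have all: "has_level_curvature \<Omega> c w 0" if P: "parallel_strip \<Omega> \<or> half_plane \<Omega>" and wc: "w \<in> level_set \<Omega> c" for c w
  proof -
    have w: "w \<in> \<Omega>" and c: "c = poincare_density \<Omega> w"
      using level[OF wc] by auto
    from P consider (strip) n a b where "n \<noteq> 0" "\<Omega> = {w. a < n \<bullet> w \<and> n \<bullet> w < b}"
      | (half) n a where "n \<noteq> 0" "\<Omega> = {w. a < n \<bullet> w}"
      unfolding parallel_strip_def half_plane_def by blast
    thus ?thesis
    proof cases
      case strip
      have "n \<bullet> (- \<i> * n) = 0"
        by (simp add: inner_complex_def)
      hence orth: "n \<bullet> (x + t *\<^sub>R (- \<i> * n)) = n \<bullet> x" for x t
        by (simp only: inner_add_right inner_scaleR_right)
      \<comment> \<open>The sign gives \<open>\<i> * v = n\<close>, so the level line at a critical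
        point is described by \<open>n\<close> itself.\<close>
      interpret translation_invariant_domain \<Omega> "- \<i> * n"
      proof unfold_locales
        show "x + t *\<^sub>R (- \<i> * n) \<in> \<Omega>" if "x \<in> \<Omega>" for x t
          using that unfolding strip(2) mem_Collect_eq orth .
      qed (use strip(1) in simp)
      show ?thesis
      proof (cases "G w = 0")
        case True
        have "level_set \<Omega> c = {x \<in> \<Omega>. n \<bullet> x = n \<bullet> w}"
          using level_set_at_critical_point[OF w True] unfolding c by simp
        \<comment> \<open>Membership in the strip depends only on \<open>n \<bullet> x\<close>, so
          the whole line lies in \<open>\<Omega>\<close>, as \<open>straight_line\<close>
          requires.\<close>
        also have "\<dots> = {x. n \<bullet> x = n \<bullet> w}"
          using w unfolding strip(2) by auto
        finally have "level_set \<Omega> c = {x. n \<bullet> x = n \<bullet> w}" .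
        hence "straight_line (level_set \<Omega> c)"
          using strip(1) unfolding straight_line_def by blast
        moreover have "parallel_strip \<Omega>"
          unfolding parallel_strip_def using strip w by (intro exI[of _ n] exI[of _ a] exI[of _ b]) auto
        ultimately show ?thesis
          using wc True w by (simp add: has_level_curvature_def grad_density_eq_0_iff)
      next
        case False
        thus ?thesis
          using wc w signed_curvature_eq_0[OF w False]
          by (simp add: has_level_curvature_def grad_density_eq_0_iff c)
      qed
    next
      case half
      have "n \<bullet> (\<i> * n) = 0"
        by (simp add: inner_complex_def)
      hence orth: "n \<bullet> (x + t *\<^sub>R (\<i> * n)) = n \<bullet> x" for x t
        by (simp only: inner_add_right inner_scaleR_right)
      interpret translation_invariant_domain \<Omega> "\<i> * n"
      proof unfold_locales
        show "x + t *\<^sub>R (\<i> * n) \<in> \<Omega>" if "x \<in> \<Omega>" for x t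
          using that unfolding half(2) mem_Collect_eq orth .
      qed (use half(1) in simp)
      have "G w \<noteq> 0"
        using half_plane_noncritical[OF half(2,1) w] .
      thus ?thesis
        using wc w signed_curvature_eq_0[OF w]
        by (simp add: has_level_curvature_def grad_density_eq_0_iff c)
    qed
  qed
  show ?thesis
    using nonneg zero all by blast
qed

end
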